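(* Let $k$ be a field of characteristic zero, $R=k[x_0,\ldots,x_4]$, and let $$\mathcal{H}_3=\begin{pmatrix} x_0&x_1&x_2\\ x_1&x_2&x_3\\ x_2&x_3&x_4\end{pmatrix}$$ be the generic $3\times 3$ Hankel matrix. Let $J\subset R$ be the gradient ideal of $\det\mathcal{H}_3$. Then $J$ is an ideal of linear type.
   Context: The gradient ideal of a polynomial is the ideal generated by all its partial derivatives. An ideal $I$ of a Noetherian ring $R$ is of linear type if the natural surjective graded $R$-algebra homomorphism $\mathcal{S}_R(I)\to\mathcal{R}_R(I)$ from the symmetric algebra of $I$ to its Rees algebra $\mathcal{R}_R(I)=\bigoplus_{t\ge 0}I^t$ is injective. *)

theory Defs
  imports
    "HOL-Analysis.Determinants"
    "HOL-Library.Numeral_Type"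
    "HOL-Library.Poly_Mapping"
    "HOL-Computational_Algebra.Polynomial"
    "HOL-Algebra.QuotRing"
    "HOL-Algebra.Ideal_Product"
    "HOL-Algebra.Algebraic_Closure_Type"
begin

section \<open>Polynomials in several variables\<close>

text \<open>Monomials are exponent vectors of finite support; the variables are all elements of
  the index type, so that the type with index type \<open>5\<close> is $k[x_0,\ldots,x_4]$.\<close>

type_synonym ('x, 'a) mpoly = "('x \<Rightarrow>\<^sub>0 nat) \<Rightarrow>\<^sub>0 'a"

definition mvar :: "'x \<Rightarrow> ('x, 'a::comm_ring_1) mpoly" where
  "mvar i = Poly_Mapping.single (Poly_Mapping.single i 1) 1"

definition mconst :: "'a \<Rightarrow> ('x, 'a::comm_ring_1) mpoly" where
  "mconst c = Poly_Mapping.single 0 c"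

text \<open>In the summand of a monomial without the variable \<open>i\<close> the exponent difference is
  truncated, but its coefficient is \<open>0\<close>.\<close>

definition mpderiv :: "'x \<Rightarrow> ('x, 'a::comm_ring_1) mpoly \<Rightarrow> ('x, 'a) mpoly" where
  "mpderiv i p = (\<Sum>m\<in>Poly_Mapping.keys p.
     Poly_Mapping.single (m - Poly_Mapping.single i 1)
       (of_nat (Poly_Mapping.lookup m i) * Poly_Mapping.lookup p m))"

definition meval ::
    "('a \<Rightarrow> 'b) \<Rightarrow> ('x \<Rightarrow> 'b) \<Rightarrow> ('x, 'a::comm_ring_1) mpoly \<Rightarrow> 'b::comm_ring_1" where
  "meval \<phi> f p = (\<Sum>m\<in>Poly_Mapping.keys p.
     \<phi> (Poly_Mapping.lookup p m) * (\<Prod>v\<in>Poly_Mapping.keys m. f v ^ Poly_Mapping.lookup m v))"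

definition gradient_ideal :: "('x, 'a::comm_ring_1) mpoly \<Rightarrow> ('x, 'a) mpoly set" where
  "gradient_ideal p = Idl\<^bsub>ring_of_type_algebra\<^esub> (range (\<lambda>i. mpderiv i p))"


section \<open>Symmetric algebra, Rees algebra and ideals of linear type\<close>

text \<open>The symmetric algebra of an ideal \<open>I\<close> of \<open>R\<close> (regarded as an \<open>R\<close>-module) is
  presented as the polynomial ring over \<open>R\<close> with one variable \<open>T a\<close> for each \<open>a \<in> I\<close>, modulo
  the relations saying that \<open>a \<mapsto> T a\<close> is \<open>R\<close>-linear.  The base ring is a whole type, hence
  \<open>ring_of_type_algebra\<close> as its ring structure.\<close>

definition sym_poly_ring :: "'r::comm_ring_1 set \<Rightarrow> ('r, 'r) mpoly ring" where
  "sym_poly_ring I = ring_of_type_algebra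
     \<lparr>carrier := {p. \<forall>m\<in>Poly_Mapping.keys p. Poly_Mapping.keys m \<subseteq> I}\<rparr>"

definition sym_rels :: "'r::comm_ring_1 set \<Rightarrow> ('r, 'r) mpoly set" where
  "sym_rels I =
     {mvar (a + b) - (mvar a + mvar b) | a b. a \<in> I \<and> b \<in> I} \<union>
     {mvar (r * a) - mconst r * mvar a | r a. a \<in> I}"

definition sym_ideal :: "'r::comm_ring_1 set \<Rightarrow> ('r, 'r) mpoly set" where
  "sym_ideal I = Idl\<^bsub>sym_poly_ring I\<^esub> (sym_rels I)"

definition sym_algebra :: "'r::comm_ring_1 set \<Rightarrow> ('r, 'r) mpoly set ring" where
  "sym_algebra I = sym_poly_ring I Quot sym_ideal I"

primrec ideal_pow :: "'r::comm_ring_1 set \<Rightarrow> nat \<Rightarrow> 'r set" where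
  "ideal_pow I 0 = UNIV"
| "ideal_pow I (Suc n) = I \<cdot>\<^bsub>ring_of_type_algebra\<^esub> ideal_pow I n"

text \<open>The direct sum of the powers of \<open>I\<close>, with its multiplication, is realised inside \<open>R[t]\<close>:
  the summand of degree \<open>n\<close> is the set of all \<open>a t\<^sup>n\<close> with \<open>a\<close> in the \<open>n\<close>-th power.\<close>

definition rees_algebra :: "'r::comm_ring_1 set \<Rightarrow> 'r poly ring" where
  "rees_algebra I = ring_of_type_algebra\<lparr>carrier := {p. \<forall>n. coeff p n \<in> ideal_pow I n}\<rparr>"

text \<open>The homomorphism induced by \<open>T a \<mapsto> a t\<close> on the polynomial ring and on its quotient.  It is
  constant on the cosets, so \<open>the_elem\<close> picks the value (see \<open>sym_to_rees_coset\<close> below).\<close>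

definition rees_eval :: "('r, 'r::comm_ring_1) mpoly \<Rightarrow> 'r poly" where
  "rees_eval = meval (\<lambda>c. [:c:]) (\<lambda>a. monom a 1)"

definition sym_to_rees :: "('r, 'r::comm_ring_1) mpoly set \<Rightarrow> 'r poly" where
  "sym_to_rees C = the_elem (rees_eval ` C)"

definition linear_type :: "'r::comm_ring_1 set \<Rightarrow> bool" where
  "linear_type I \<longleftrightarrow> inj_on sym_to_rees (carrier (sym_algebra I))"


section \<open>The generic Hankel matrix\<close>

definition hankel3 :: "(5, 'k::comm_ring_1) mpoly ^ 3 ^ 3" where
  "hankel3 = vector [vector [mvar 0, mvar 1, mvar 2],
                     vector [mvar 1, mvar 2, mvar 3],
                     vector [mvar 2, mvar 3, mvar 4]]"


section \<open>The natural map is a well-defined surjective homomorphism\<close>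

lemma ring_of_type_algebra_simps [simp]:
  "carrier (ring_of_type_algebra :: 'a::comm_ring_1 ring) = UNIV"
  "x \<otimes>\<^bsub>ring_of_type_algebra\<^esub> y = x * (y :: 'a)"
  "x \<oplus>\<^bsub>ring_of_type_algebra\<^esub> y = x + (y :: 'a)"
  "\<one>\<^bsub>ring_of_type_algebra\<^esub> = (1 :: 'a)"
  "\<zero>\<^bsub>ring_of_type_algebra\<^esub> = (0 :: 'a)"
  by (simp_all add: ring_of_type_algebra_def)

lemma cring_subring_of_type:
  fixes S :: "'a::comm_ring_1 set"
  assumes "0 \<in> S" "1 \<in> S" "\<And>x. x \<in> S \<Longrightarrow> - x \<in> S"
    "\<And>x y. x \<in> S \<Longrightarrow> y \<in> S \<Longrightarrow> x + y \<in> S" "\<And>x y. x \<in> S \<Longrightarrow> y \<in> S \<Longrightarrow> x * y \<in> S"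
  shows "cring (ring_of_type_algebra\<lparr>carrier := S\<rparr>)"
proof (intro cringI abelian_groupI comm_monoidI)
  fix x assume "x \<in> carrier (ring_of_type_algebra\<lparr>carrier := S\<rparr>)"
  then show "\<exists>y\<in>carrier (ring_of_type_algebra\<lparr>carrier := S\<rparr>).
      y \<oplus>\<^bsub>ring_of_type_algebra\<lparr>carrier := S\<rparr>\<^esub> x = \<zero>\<^bsub>ring_of_type_algebra\<lparr>carrier := S\<rparr>\<^esub>"
    using assms(3) by (auto simp: ring_of_type_algebra_def intro!: bexI[of _ "- x"])
qed (use assms in \<open>auto simp: ring_of_type_algebra_def algebra_simps\<close>)

lemma mpoly_sum_monomials:
  "(\<Sum>m\<in>Poly_Mapping.keys p. Poly_Mapping.single m (Poly_Mapping.lookup p m)) = p"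
  by (rule poly_mapping_eqI)
     (auto simp: lookup_sum lookup_single when_def in_keys_iff sum.delta')

lemma mprod_superset:
  fixes f :: "'x \<Rightarrow> 'b::comm_ring_1"
  assumes "finite A" "Poly_Mapping.keys m \<subseteq> A"
  shows "(\<Prod>v\<in>Poly_Mapping.keys m. f v ^ Poly_Mapping.lookup m v) =
    (\<Prod>v\<in>A. f v ^ Poly_Mapping.lookup m v)"
  using assms by (intro prod.mono_neutral_left) (auto simp: in_keys_iff)

lemma mprod_add:
  fixes f :: "'x \<Rightarrow> 'b::comm_ring_1"
  shows "(\<Prod>v\<in>Poly_Mapping.keys (m + n). f v ^ Poly_Mapping.lookup (m + n) v) =
    (\<Prod>v\<in>Poly_Mapping.keys m. f v ^ Poly_Mapping.lookup m v) *
    (\<Prod>v\<in>Poly_Mapping.keys n. f v ^ Poly_Mapping.lookup n v)"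
proof -
  let ?A = "Poly_Mapping.keys m \<union> Poly_Mapping.keys n"
  show ?thesis
    using mprod_superset[of ?A m f] mprod_superset[of ?A n f] mprod_superset[of ?A "m + n" f]
      Poly_Mapping.keys_add[of m n]
    by (simp add: lookup_add power_add prod.distrib)
qed

context
  fixes \<phi> :: "'a::comm_ring_1 \<Rightarrow> 'b::comm_ring_1" and f :: "'x \<Rightarrow> 'b"
  assumes \<phi>_0: "\<phi> 0 = 0" and \<phi>_1: "\<phi> 1 = 1"
    and \<phi>_add: "\<And>x y. \<phi> (x + y) = \<phi> x + \<phi> y" and \<phi>_mult: "\<And>x y. \<phi> (x * y) = \<phi> x * \<phi> y"
begin

lemma meval_superset:
  assumes "finite A" "Poly_Mapping.keys p \<subseteq> A"
  shows "meval \<phi> f p = (\<Sum>m\<in>A. \<phi> (Poly_Mapping.lookup p m) *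
    (\<Prod>v\<in>Poly_Mapping.keys m. f v ^ Poly_Mapping.lookup m v))"
  unfolding meval_def using assms
  by (intro sum.mono_neutral_left) (auto simp: in_keys_iff \<phi>_0)

lemma meval_single:
  "meval \<phi> f (Poly_Mapping.single m c) =
    \<phi> c * (\<Prod>v\<in>Poly_Mapping.keys m. f v ^ Poly_Mapping.lookup m v)"
  by (subst meval_superset[of "{m}"]) auto

lemma meval_zero: "meval \<phi> f 0 = 0"
  by (simp add: meval_def)

lemma meval_one: "meval \<phi> f 1 = 1"
  using meval_single[of 0 1] by (simp add: \<phi>_1)

lemma meval_mconst: "meval \<phi> f (mconst c) = \<phi> c"
  using meval_single[of 0 c] by (simp add: mconst_def)

lemma meval_mvar: "meval \<phi> f (mvar v) = f v"
  by (simp add: mvar_def meval_single \<phi>_1)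

lemma meval_add: "meval \<phi> f (p + q) = meval \<phi> f p + meval \<phi> f q"
proof -
  let ?A = "Poly_Mapping.keys p \<union> Poly_Mapping.keys q"
  show ?thesis
    using meval_superset[of ?A p] meval_superset[of ?A q] meval_superset[of ?A "p + q"]
      Poly_Mapping.keys_add[of p q]
    by (simp add: lookup_add \<phi>_add sum.distrib distrib_right)
qed

lemma meval_uminus: "meval \<phi> f (- p) = - meval \<phi> f p"
  using meval_add[of p "- p"] by (simp add: meval_zero eq_neg_iff_add_eq_0 add.commute)

lemma meval_diff: "meval \<phi> f (p - q) = meval \<phi> f p - meval \<phi> f q"
  using meval_add[of p "- q"] by (simp add: meval_uminus)

lemma meval_sum: "meval \<phi> f (sum g A) = (\<Sum>x\<in>A. meval \<phi> f (g x))"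
  by (induction A rule: infinite_finite_induct) (simp_all add: meval_zero meval_add)

lemma meval_mult: "meval \<phi> f (p * q) = meval \<phi> f p * meval \<phi> f q"
proof -
  let ?s = "\<lambda>p m. Poly_Mapping.single m (Poly_Mapping.lookup p m)"
  have "p * q = (\<Sum>m\<in>Poly_Mapping.keys p. ?s p m) * (\<Sum>n\<in>Poly_Mapping.keys q. ?s q n)"
    by (simp add: mpoly_sum_monomials)
  also have "meval \<phi> f \<dots> = (\<Sum>m\<in>Poly_Mapping.keys p. \<Sum>n\<in>Poly_Mapping.keys q.
      meval \<phi> f (?s p m) * meval \<phi> f (?s q n))"
    by (simp add: sum_product meval_sum mult_single meval_single mprod_add \<phi>_mult mult_ac)
  also have "\<dots> = (\<Sum>m\<in>Poly_Mapping.keys p. meval \<phi> f (?s p m)) *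
      (\<Sum>n\<in>Poly_Mapping.keys q. meval \<phi> f (?s q n))"
    by (simp add: sum_product)
  also have "\<dots> = meval \<phi> f p * meval \<phi> f q"
    by (simp only: meval_def[of \<phi> f p] meval_def[of \<phi> f q] meval_single)
  finally show ?thesis .
qed

end

lemma rees_eval_mconst: "rees_eval (mconst c) = [:c:]"
  unfolding rees_eval_def by (rule meval_mconst) auto

lemma rees_eval_mvar: "rees_eval (mvar a) = monom a 1"
  unfolding rees_eval_def by (rule meval_mvar) (auto simp: one_pCons)

lemma rees_eval_zero: "rees_eval 0 = 0"
  unfolding rees_eval_def by (rule meval_zero) auto

lemma rees_eval_one: "rees_eval 1 = 1"
  unfolding rees_eval_def by (rule meval_one) (auto simp: one_pCons)

lemma rees_eval_add: "rees_eval (p + q) = rees_eval p + rees_eval q"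
  unfolding rees_eval_def by (rule meval_add) auto

lemma rees_eval_diff: "rees_eval (p - q) = rees_eval p - rees_eval q"
  unfolding rees_eval_def by (rule meval_diff) auto

lemma rees_eval_mult: "rees_eval (p * q) = rees_eval p * rees_eval q"
  unfolding rees_eval_def by (rule meval_mult) auto

lemma rees_eval_single:
  "rees_eval (Poly_Mapping.single m c) =
    [:c:] * (\<Prod>v\<in>Poly_Mapping.keys m. monom v 1 ^ Poly_Mapping.lookup m v)"
  unfolding rees_eval_def by (rule meval_single) auto

lemma rees_eval_sum: "rees_eval (sum g A) = (\<Sum>x\<in>A. rees_eval (g x))"
  unfolding rees_eval_def by (rule meval_sum) auto

lemma ideal_gradient_ideal: "ideal (gradient_ideal p) ring_of_type_algebra"
  unfolding gradient_ideal_def by (intro ring.genideal_ideal ring_from_type_algebra) simp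

lemma ideal_type_closed:
  fixes K :: "'r::comm_ring_1 set"
  assumes "ideal K ring_of_type_algebra"
  shows "0 \<in> K" "a \<in> K \<Longrightarrow> b \<in> K \<Longrightarrow> a + b \<in> K" "a \<in> K \<Longrightarrow> r * a \<in> K" "a \<in> K \<Longrightarrow> - a \<in> K"
proof -
  note sub = ideal.axioms(1)[OF assms]
  show "0 \<in> K" "a \<in> K \<Longrightarrow> b \<in> K \<Longrightarrow> a + b \<in> K"
    using additive_subgroup.zero_closed[OF sub] additive_subgroup.a_closed[OF sub, of a b] by simp_all
  show mult: "a \<in> K \<Longrightarrow> r * a \<in> K" for r
    using ideal.I_l_closed[OF assms, of a r] by simp
  show "a \<in> K \<Longrightarrow> - a \<in> K"
    using mult[of "- 1"] by simp
qed

context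
  fixes I :: "'r::comm_ring_1 set"
  assumes I: "ideal I ring_of_type_algebra"
begin

lemma ideal_ideal_pow: "ideal (ideal_pow I n) ring_of_type_algebra"
proof (induction n)
  case 0
  then show ?case
    using ring.oneideal[OF ring_from_type_algebra] by simp
next
  case (Suc n)
  then show ?case
    using I ring.ideal_prod_is_ideal[OF ring_from_type_algebra] by simp
qed

lemma ideal_pow_mult:
  "a \<in> ideal_pow I m \<Longrightarrow> b \<in> ideal_pow I n \<Longrightarrow> a * b \<in> ideal_pow I (m + n)"
proof (induction m arbitrary: a)
  case 0
  then show ?case
    using ideal_type_closed(3)[OF ideal_ideal_pow] by simp
next
  case (Suc m)
  from Suc.prems(1) have "a \<in> I \<cdot>\<^bsub>ring_of_type_algebra\<^esub> ideal_pow I m"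
    by simp
  then show ?case
  proof (induction rule: ideal_prod.induct)
    case (prod i j)
    then have "i \<otimes>\<^bsub>ring_of_type_algebra\<^esub> (j * b) \<in>
        I \<cdot>\<^bsub>ring_of_type_algebra\<^esub> ideal_pow I (m + n)"
      using Suc.IH Suc.prems(2) by (intro ideal_prod.prod) auto
    then show ?case
      by (simp add: mult.assoc)
  next
    case (sum s1 s2)
    then show ?case
      using ideal_type_closed(2)[OF ideal_ideal_pow[of "Suc m + n"]]
      by (simp only: distrib_right ring_of_type_algebra_simps)
  qed
qed

lemma cring_rees_algebra: "cring (rees_algebra I)"
  unfolding rees_algebra_def
proof (rule cring_subring_of_type)
  show "1 \<in> {p. \<forall>n. coeff p n \<in> ideal_pow I n}"
    using ideal_type_closed(1)[OF ideal_ideal_pow]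
    by (simp add: coeff_1 del: ideal_pow.simps(2))
  show "x * y \<in> {p. \<forall>n. coeff p n \<in> ideal_pow I n}"
    if "x \<in> {p. \<forall>n. coeff p n \<in> ideal_pow I n}" "y \<in> {p. \<forall>n. coeff p n \<in> ideal_pow I n}"
    for x y :: "'r poly"
  proof clarify
    fix n
    have summand: "coeff x i * coeff y (n - i) \<in> ideal_pow I n" if "i \<le> n" for i
      using ideal_pow_mult[of "coeff x i" i "coeff y (n - i)" "n - i"] that
        \<open>x \<in> _\<close> \<open>y \<in> _\<close> by simp
    have "(\<Sum>i\<in>A. coeff x i * coeff y (n - i)) \<in> ideal_pow I n"
      if "finite A" "A \<subseteq> {..n}" for A
      using that
      by (induction A rule: finite_induct) (simp_all add: ideal_type_closed[OF ideal_ideal_pow] summand)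
    then show "coeff (x * y) n \<in> ideal_pow I n"
      by (simp add: coeff_mult)
  qed
qed (auto simp: ideal_type_closed[OF ideal_ideal_pow])

lemma cring_sym_poly_ring: "cring (sym_poly_ring I)"
  unfolding sym_poly_ring_def
proof (rule cring_subring_of_type)
  fix x y :: "('r, 'r) mpoly"
  assume xy: "x \<in> {p. \<forall>m\<in>Poly_Mapping.keys p. Poly_Mapping.keys m \<subseteq> I}"
    "y \<in> {p. \<forall>m\<in>Poly_Mapping.keys p. Poly_Mapping.keys m \<subseteq> I}"
  show "x + y \<in> {p. \<forall>m\<in>Poly_Mapping.keys p. Poly_Mapping.keys m \<subseteq> I}"
    using xy Poly_Mapping.keys_add[of x y] by blast
  show "x * y \<in> {p. \<forall>m\<in>Poly_Mapping.keys p. Poly_Mapping.keys m \<subseteq> I}"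
  proof clarify
    fix m v assume "m \<in> Poly_Mapping.keys (x * y)" "v \<in> Poly_Mapping.keys m"
    then obtain a b where "m = a + b" "a \<in> Poly_Mapping.keys x" "b \<in> Poly_Mapping.keys y"
      using keys_mult[of x y] by blast
    then show "v \<in> I"
      using xy \<open>v \<in> Poly_Mapping.keys m\<close> Poly_Mapping.keys_add[of a b] by blast
  qed
qed (auto simp: in_keys_iff)

lemma sym_poly_ring_simps:
  "carrier (sym_poly_ring I) = {p. \<forall>m\<in>Poly_Mapping.keys p. Poly_Mapping.keys m \<subseteq> I}"
  "x \<otimes>\<^bsub>sym_poly_ring I\<^esub> y = x * y" "x \<oplus>\<^bsub>sym_poly_ring I\<^esub> y = x + y"
  "\<one>\<^bsub>sym_poly_ring I\<^esub> = 1" "\<zero>\<^bsub>sym_poly_ring I\<^esub> = 0"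
  by (simp_all add: sym_poly_ring_def ring_of_type_algebra_def)

lemma rees_algebra_simps:
  "carrier (rees_algebra I) = {p. \<forall>n. coeff p n \<in> ideal_pow I n}"
  "p \<otimes>\<^bsub>rees_algebra I\<^esub> q = p * q" "p \<oplus>\<^bsub>rees_algebra I\<^esub> q = p + q"
  "\<one>\<^bsub>rees_algebra I\<^esub> = 1" "\<zero>\<^bsub>rees_algebra I\<^esub> = 0"
  by (simp_all add: rees_algebra_def ring_of_type_algebra_def)

lemma mvar_in_sym_poly_ring: "a \<in> I \<Longrightarrow> mvar a \<in> carrier (sym_poly_ring I)"
  by (simp add: sym_poly_ring_simps mvar_def)

lemma mconst_in_sym_poly_ring: "mconst c \<in> carrier (sym_poly_ring I)"
  by (simp add: sym_poly_ring_simps mconst_def)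

lemma sym_poly_ring_diff:
  assumes "p \<in> carrier (sym_poly_ring I)" "q \<in> carrier (sym_poly_ring I)"
  shows "p - q \<in> carrier (sym_poly_ring I)"
proof -
  have "- q \<in> carrier (sym_poly_ring I)"
    using assms(2) by (auto simp: sym_poly_ring_simps in_keys_iff)
  then show ?thesis
    using cring.cring_simprules(1)[OF cring_sym_poly_ring assms(1), of "- q"]
    by (simp add: sym_poly_ring_simps(3))
qed

lemma sym_rels_subset: "sym_rels I \<subseteq> carrier (sym_poly_ring I)"
proof -
  interpret P: cring "sym_poly_ring I" by (rule cring_sym_poly_ring)
  note closed = mvar_in_sym_poly_ring mconst_in_sym_poly_ring sym_poly_ring_diff
    P.add.m_closed[unfolded sym_poly_ring_simps(3)] P.m_closed[unfolded sym_poly_ring_simps(2)]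
    ideal_type_closed[OF I]
  show ?thesis
    unfolding sym_rels_def by (auto intro!: closed simp: sym_poly_ring_simps(3))
qed

lemma ideal_sym_ideal: "ideal (sym_ideal I) (sym_poly_ring I)"
  unfolding sym_ideal_def
  by (intro ring.genideal_ideal sym_rels_subset cring.axioms(1) cring_sym_poly_ring)

lemma rees_eval_carrier:
  assumes "p \<in> carrier (sym_poly_ring I)"
  shows "rees_eval p \<in> carrier (rees_algebra I)"
proof -
  interpret S: cring "rees_algebra I" by (rule cring_rees_algebra)
  note mult = S.m_closed[unfolded rees_algebra_simps(2)]
    and add = S.add.m_closed[simplified, unfolded rees_algebra_simps(3)]
    and one = S.one_closed[unfolded rees_algebra_simps(4)]
    and zero = S.zero_closed[unfolded rees_algebra_simps(5)]
  have pow: "q ^ n \<in> carrier (rees_algebra I)" if "q \<in> carrier (rees_algebra I)" for q n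
    using that by (induction n) (auto intro: mult one)
  have var: "monom a 1 \<in> carrier (rees_algebra I)" if "a \<in> I" for a
  proof -
    have "a \<in> ideal_pow I 1"
      using ideal_prod.prod[OF that UNIV_I, of ring_of_type_algebra 1] by simp
    then show ?thesis
      using ideal_type_closed(1)[OF ideal_ideal_pow] by (auto simp: rees_algebra_simps)
  qed
  have const: "[:c:] \<in> carrier (rees_algebra I)" for c
    using ideal_type_closed(1)[OF ideal_ideal_pow]
    by (auto simp: rees_algebra_simps coeff_pCons simp del: ideal_pow.simps(2) split: nat.split)
  have prod: "(\<Prod>v\<in>A. monom v 1 ^ k v) \<in> carrier (rees_algebra I)"
    if "finite A" "A \<subseteq> I" for A and k :: "'r \<Rightarrow> nat"
    using that by (induction A rule: finite_induct) (simp_all add: mult one pow var[simplified])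
  have "(\<Sum>m\<in>M. [:Poly_Mapping.lookup p m:] *
      (\<Prod>v\<in>Poly_Mapping.keys m. monom v 1 ^ Poly_Mapping.lookup m v)) \<in> carrier (rees_algebra I)"
    if "finite M" "M \<subseteq> Poly_Mapping.keys p" for M
    using that assms
    by (induction M rule: finite_induct)
       (simp_all add: add zero mult[OF const prod[simplified]]
         sym_poly_ring_simps(1) del: mult_pCons_left)
  then show ?thesis
    by (simp add: rees_eval_def meval_def)
qed

lemma rees_eval_hom: "ring_hom_ring (sym_poly_ring I) (rees_algebra I) rees_eval"
  using cring_sym_poly_ring cring_rees_algebra rees_eval_carrier
  by (intro ring_hom_ringI)
     (auto simp: cring.axioms(1) sym_poly_ring_simps(2-5) rees_algebra_simps(2-5)
       rees_eval_add rees_eval_mult rees_eval_one)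

lemma rees_eval_sym_ideal:
  assumes "p \<in> sym_ideal I"
  shows "rees_eval p = 0"
proof -
  interpret h: ring_hom_ring "sym_poly_ring I" "rees_algebra I" rees_eval
    by (rule rees_eval_hom)
  have rels: "rees_eval x = 0" if x: "x \<in> sym_rels I" for x
  proof -
    consider a b where "x = mvar (a + b) - (mvar a + mvar b)"
      | r a where "x = mvar (r * a) - mconst r * mvar a"
      using x unfolding sym_rels_def by blast
    then show ?thesis
      by cases
         (simp_all only: rees_eval_diff rees_eval_add rees_eval_mult rees_eval_mvar
           rees_eval_mconst add_monom[symmetric], simp_all add: smult_monom)
  qed
  have "sym_rels I \<subseteq> a_kernel (sym_poly_ring I) (rees_algebra I) rees_eval"
    unfolding a_kernel_def' rees_algebra_simps(5) using sym_rels_subset rels by blast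
  then have "sym_ideal I \<subseteq> a_kernel (sym_poly_ring I) (rees_algebra I) rees_eval"
    unfolding sym_ideal_def by (rule h.R.genideal_minimal[OF h.kernel_is_ideal])
  then have "p \<in> a_kernel (sym_poly_ring I) (rees_algebra I) rees_eval"
    using assms by blast
  then show ?thesis
    unfolding a_kernel_def' rees_algebra_simps(5) by blast
qed

lemma sym_to_rees_coset:
  assumes "p \<in> carrier (sym_poly_ring I)"
  shows "sym_to_rees (sym_ideal I +>\<^bsub>sym_poly_ring I\<^esub> p) = rees_eval p"
proof -
  have "sym_ideal I +>\<^bsub>sym_poly_ring I\<^esub> p = (\<lambda>x. x + p) ` sym_ideal I"
    by (auto simp: a_r_coset_def' sym_poly_ring_simps(3))
  moreover have "rees_eval (x + p) = rees_eval p" if "x \<in> sym_ideal I" for x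
    using that by (simp only: rees_eval_add rees_eval_sym_ideal add_0_left)
  moreover have "sym_ideal I \<noteq> {}"
    using additive_subgroup.zero_closed[OF ideal.axioms(1)[OF ideal_sym_ideal]] by blast
  ultimately have "rees_eval ` (sym_ideal I +>\<^bsub>sym_poly_ring I\<^esub> p) = {rees_eval p}"
    by (simp add: image_image image_constant_conv cong: image_cong)
  then show ?thesis
    by (simp add: sym_to_rees_def)
qed

lemma sym_algebra_carrierE:
  assumes "C \<in> carrier (sym_algebra I)"
  obtains p where "p \<in> carrier (sym_poly_ring I)" "C = sym_ideal I +>\<^bsub>sym_poly_ring I\<^esub> p"
  using assms by (auto simp: sym_algebra_def FactRing_def A_RCOSETS_def' intro: that)

lemma sym_to_rees_hom: "sym_to_rees \<in> ring_hom (sym_algebra I) (rees_algebra I)"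
proof -
  interpret ideal "sym_ideal I" "sym_poly_ring I" by (rule ideal_sym_ideal)
  interpret h: ring_hom_ring "sym_poly_ring I" "rees_algebra I" rees_eval
    by (rule rees_eval_hom)
  note hom = rcos_ring_hom[folded sym_algebra_def]
  show ?thesis
  proof (rule ring_hom_memI)
    fix C D assume "C \<in> carrier (sym_algebra I)" "D \<in> carrier (sym_algebra I)"
    then obtain p q where pq: "p \<in> carrier (sym_poly_ring I)" "q \<in> carrier (sym_poly_ring I)"
      and CD: "C = sym_ideal I +>\<^bsub>sym_poly_ring I\<^esub> p" "D = sym_ideal I +>\<^bsub>sym_poly_ring I\<^esub> q"
      by (metis sym_algebra_carrierE)
    show "sym_to_rees C \<in> carrier (rees_algebra I)"
      using pq by (simp add: CD sym_to_rees_coset)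
    show "sym_to_rees (C \<otimes>\<^bsub>sym_algebra I\<^esub> D) = sym_to_rees C \<otimes>\<^bsub>rees_algebra I\<^esub> sym_to_rees D"
      using pq by (simp add: CD sym_to_rees_coset flip: ring_hom_mult[OF hom])
    show "sym_to_rees (C \<oplus>\<^bsub>sym_algebra I\<^esub> D) = sym_to_rees C \<oplus>\<^bsub>rees_algebra I\<^esub> sym_to_rees D"
      using pq by (simp add: CD sym_to_rees_coset flip: ring_hom_add[OF hom])
  next
    show "sym_to_rees \<one>\<^bsub>sym_algebra I\<^esub> = \<one>\<^bsub>rees_algebra I\<^esub>"
      by (simp add: sym_to_rees_coset flip: ring_hom_one[OF hom])
  qed
qed

lemma ideal_pow_monom_in_range:
  "a \<in> ideal_pow I n \<Longrightarrow> \<exists>p\<in>carrier (sym_poly_ring I). rees_eval p = monom a n"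
proof (induction n arbitrary: a)
  case 0
  then show ?case
    using mconst_in_sym_poly_ring rees_eval_mconst by (metis monom_0)
next
  case (Suc n)
  interpret P: cring "sym_poly_ring I" by (rule cring_sym_poly_ring)
  from Suc.prems have "a \<in> I \<cdot>\<^bsub>ring_of_type_algebra\<^esub> ideal_pow I n"
    by simp
  then show ?case
  proof (induction rule: ideal_prod.induct)
    case (prod i j)
    then obtain p where p: "p \<in> carrier (sym_poly_ring I)" "rees_eval p = monom j n"
      using Suc.IH by blast
    have "mvar i * p \<in> carrier (sym_poly_ring I)"
      using P.m_closed[OF mvar_in_sym_poly_ring[OF prod(1)] p(1)]
      by (simp add: sym_poly_ring_simps(2))
    then show ?case
      using p(2) by (intro bexI) (simp_all add: rees_eval_mult rees_eval_mvar mult_monom)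
  next
    case (sum s1 s2)
    then obtain p q where "p \<in> carrier (sym_poly_ring I)" "rees_eval p = monom s1 (Suc n)"
      "q \<in> carrier (sym_poly_ring I)" "rees_eval q = monom s2 (Suc n)"
      by blast
    then show ?case
      using P.add.m_closed[of p q]
      by (intro bexI[of _ "p + q"]) (simp_all add: rees_eval_add add_monom sym_poly_ring_simps(3))
  qed
qed

lemma sym_to_rees_surj: "sym_to_rees ` carrier (sym_algebra I) = carrier (rees_algebra I)"
proof
  show "sym_to_rees ` carrier (sym_algebra I) \<subseteq> carrier (rees_algebra I)"
    using ring_hom_closed[OF sym_to_rees_hom] by blast
  show "carrier (rees_algebra I) \<subseteq> sym_to_rees ` carrier (sym_algebra I)"
  proof
    fix r assume "r \<in> carrier (rees_algebra I)"
    then have "\<forall>n. \<exists>p\<in>carrier (sym_poly_ring I). rees_eval p = monom (coeff r n) n"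
      using ideal_pow_monom_in_range by (simp add: rees_algebra_simps)
    then obtain g where g: "g n \<in> carrier (sym_poly_ring I)"
      "rees_eval (g n) = monom (coeff r n) n" for n
      by metis
    interpret P: cring "sym_poly_ring I" by (rule cring_sym_poly_ring)
    have carr: "(\<Sum>n\<in>A. g n) \<in> carrier (sym_poly_ring I)" for A
      using P.add.m_closed P.zero_closed g(1)
      by (induction A rule: infinite_finite_induct) (simp_all add: sym_poly_ring_simps(3,5))
    have "rees_eval (\<Sum>n\<le>degree r. g n) = r"
      by (simp add: rees_eval_sum g(2) poly_as_sum_of_monoms)
    moreover have "sym_ideal I +>\<^bsub>sym_poly_ring I\<^esub> (\<Sum>n\<le>degree r. g n) \<in> carrier (sym_algebra I)"
      using carr by (auto simp: sym_algebra_def FactRing_def A_RCOSETS_def')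
    ultimately show "r \<in> sym_to_rees ` carrier (sym_algebra I)"
      using sym_to_rees_coset[OF carr] by (metis image_eqI)
  qed
qed

end

end

theory Submission
  imports Defs
begin

text \<open>Put $p = x_2x_3 - x_1x_4$ and $q = x_1x_2 - x_0x_3$.  The partial derivatives of
  $\det\mathcal{H}_3$ span the same space of quadrics as
  $a_0 = x_2x_4 - x_3^2$, $a_1 = x_0x_2 - x_1^2$, $a_2 = x_0x_4 + 2x_1x_3 - 3x_2^2$,
  $a_3 = p + 3q$ and $a_4 = q$ (\<open>gradient_ideal_hankel\<close>).  These form a relative regular
  sequence: if $u \<in> J$ and $a_i u \<in> (a_0,\ldots,a_{i-1})$, then $u \<in> (a_0,\ldots,a_{i-1})$.

  An ideal $I$ generated by such a sequence is of linear type
  (\<open>relative_regular_sequence_linear_type\<close>).  First, $(a_0,\ldots,a_{i-1}) \cap I^{d+1} =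
  (a_0,\ldots,a_{i-1}) I^d$ (\<open>artin_rees\<close>).  Now let a form
  $F = T_i G + H$ of degree $d + 1$, with $d \<ge> 1$ and $H \<in> (T_0,\ldots,T_{i-1})$, vanish at $a$.  Then
  $a_i G(a) \<in> (a_0,\ldots,a_{i-1})$, so $G(a)$ lies in $(a_0,\ldots,a_{i-1}) \cap I^d$ and is the
  value of a form $G' \<in> (T_0,\ldots,T_{i-1})$ of degree $d$.  By induction on the degree $G - G'$
  is a consequence of the linear relations; so $F$ may be replaced by $T_i G' + H$, which lies in
  $(T_0,\ldots,T_{i-1})$, and induction on $i$ finishes the argument.

  Why the sequence is relative regular: the ideals $(a_0)$ and $(a_0, a_1)$ are kernels of monomial
  substitutions, hence prime, and the next generator does not vanish under the substitution
  (\<open>quadric_cone_kernel\<close>, \<open>quadric_pair_cone_kernel\<close>).  The quadrics $a_0, a_1, a_2$ cut out the union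
  of two quartic curves in projective 4-space, namely the rational normal curve $C$, on which all
  of $J$ vanishes, and the residual curve $C'$ of all points $(1, t, t^2, -3t^3, 9t^4)$.  On $C'$
  one finds $p = -12t^5$ and $q = 4t^3$, so $a_3$ is not zero there, and $a_3 u \<in> (a_0,a_1,a_2)$
  makes $u$ vanish on $C'$; together with $u \<in> J$ this puts $u$ into $(a_0,a_1,a_2)$
  (\<open>residual_cone_kernel\<close>).  Finally $a_3 = 12 t^3 (1 - t^2)$ on $C'$ is a multiple of $a_4 = 4t^3$,
  so that only the two points $t = \pm 1$ obstruct cancelling $a_4$: from
  $a_4^2 \alpha \<in> (a_0,\ldots,a_3)$ it follows that $\alpha$ vanishes at them, and $a_4$ times the
  ideal of these two points is contained in $(a_0,\ldots,a_3)$ (\<open>minor_q_colon\<close>).\<close>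

section \<open>Polynomials in several variables\<close>

lemma mvar_times_single:
  "mvar v * Poly_Mapping.single m c = Poly_Mapping.single (Poly_Mapping.single v 1 + m) c"
  by (simp add: mvar_def mult_single)

lemma mconst_simps:
  "mconst 0 = 0" "mconst 1 = 1" "mconst (c + d) = mconst c + mconst d"
  "mconst (c * d) = mconst c * mconst d" "mconst (- c) = - mconst c"
  by (simp_all add: mconst_def single_add mult_single single_uminus)

lemma mpoly_induct_vars [consumes 1, case_names const add mult_var]:
  fixes p :: "('x, 'a::comm_ring_1) mpoly"
  assumes vars: "\<forall>m\<in>Poly_Mapping.keys p. Poly_Mapping.keys m \<subseteq> V"
    and const: "\<And>c. P (mconst c)"
    and add: "\<And>p q. P p \<Longrightarrow> P q \<Longrightarrow> P (p + q)"
    and mult_var: "\<And>v p. v \<in> V \<Longrightarrow> P p \<Longrightarrow> P (mvar v * p)"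
  shows "P p"
proof -
  have single: "P (Poly_Mapping.single m c)" if "Poly_Mapping.keys m \<subseteq> V" for m c
    using that
  proof (induction "\<Sum>v\<in>Poly_Mapping.keys m. Poly_Mapping.lookup m v" arbitrary: m rule: less_induct)
    case less
    show ?case
    proof (cases "m = 0")
      case True
      then show ?thesis
        using const[of c] by (simp add: mconst_def)
    next
      case False
      then obtain v where v: "v \<in> Poly_Mapping.keys m"
        by fastforce
      define n where "n = m - Poly_Mapping.single v 1"
      have m: "m = Poly_Mapping.single v 1 + n"
        using v by (intro poly_mapping_eqI)
          (auto simp: n_def lookup_add lookup_minus lookup_single when_def in_keys_iff)
      have sub: "Poly_Mapping.keys n \<subseteq> Poly_Mapping.keys m"
        by (auto simp: n_def in_keys_iff lookup_minus)
      have "(\<Sum>v\<in>Poly_Mapping.keys n. Poly_Mapping.lookup n v)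
          = (\<Sum>v\<in>Poly_Mapping.keys m. Poly_Mapping.lookup n v)"
        using sub by (intro sum.mono_neutral_left) (auto simp: in_keys_iff)
      also have "\<dots> < (\<Sum>v\<in>Poly_Mapping.keys m. Poly_Mapping.lookup m v)"
        using v by (intro sum_strict_mono_ex1)
          (auto simp: n_def lookup_minus lookup_single when_def in_keys_iff)
      finally have "P (Poly_Mapping.single n c)"
        using less sub by blast
      then show ?thesis
        using mult_var[of v] v less.prems by (subst m) (auto simp flip: mvar_times_single[unfolded One_nat_def])
    qed
  qed
  have "P (\<Sum>m\<in>M. Poly_Mapping.single m (Poly_Mapping.lookup p m))"
    if "finite M" "M \<subseteq> Poly_Mapping.keys p" for M
    using that
  proof (induction M rule: finite_induct)
    case empty
    then show ?case
      using const[of 0] by (simp add: mconst_def)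
  next
    case (insert m M)
    then show ?case
      using vars by (auto intro!: add single)
  qed
  from this[of "Poly_Mapping.keys p"] show ?thesis
    by (simp add: mpoly_sum_monomials)
qed


section \<open>Linear combinations of the first terms of a sequence\<close>

text \<open>The cofactors range over a set, so that one notion gives ideals $(s_0,\ldots,s_{i-1})$ (all
  cofactors), their products with a power of an ideal, and homogeneous forms (cofactors of one
  degree less).\<close>

primrec lincomb :: "(nat \<Rightarrow> 'b::comm_ring_1) \<Rightarrow> 'b set \<Rightarrow> nat \<Rightarrow> 'b set" where
  "lincomb s M 0 = {0}"
| "lincomb s M (Suc i) = {s i * g + h | g h. g \<in> M \<and> h \<in> lincomb s M i}"

lemma lincomb_SucI: "g \<in> M \<Longrightarrow> h \<in> lincomb s M i \<Longrightarrow> s i * g + h \<in> lincomb s M (Suc i)"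
  by auto

lemma lincomb_SucE:
  assumes "x \<in> lincomb s M (Suc i)"
  obtains g h where "x = s i * g + h" "g \<in> M" "h \<in> lincomb s M i"
  using assms by auto

lemma lincomb_add:
  assumes "\<And>g h. g \<in> M \<Longrightarrow> h \<in> M \<Longrightarrow> g + h \<in> M"
  shows "x \<in> lincomb s M i \<Longrightarrow> y \<in> lincomb s M i \<Longrightarrow> x + y \<in> lincomb s M i"
proof (induction i arbitrary: x y)
  case (Suc i)
  then obtain g h g' h' where "x = s i * g + h" "y = s i * g' + h'" "g \<in> M" "g' \<in> M"
    "h \<in> lincomb s M i" "h' \<in> lincomb s M i"
    by auto
  moreover from this have "x + y = s i * (g + g') + (h + h')"
    by (simp add: algebra_simps)
  ultimately show ?case
    using assms Suc.IH by (simp only: lincomb_SucI)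
qed simp

lemma lincomb_mult:
  assumes "\<And>g. g \<in> M \<Longrightarrow> r * g \<in> M'"
  shows "x \<in> lincomb s M i \<Longrightarrow> r * x \<in> lincomb s M' i"
proof (induction i arbitrary: x)
  case (Suc i)
  then obtain g h where "x = s i * g + h" "g \<in> M" "h \<in> lincomb s M i"
    by auto
  moreover from this have "r * x = s i * (r * g) + r * h"
    by (simp add: algebra_simps)
  ultimately show ?case
    using assms Suc.IH by (simp only: lincomb_SucI)
qed simp

lemma lincomb_mono: "M \<subseteq> M' \<Longrightarrow> lincomb s M i \<subseteq> lincomb s M' i"
  by (induction i) auto

lemma lincomb_Suc_subset: "0 \<in> M \<Longrightarrow> lincomb s M i \<subseteq> lincomb s M (Suc i)"
  by force

lemma zero_in_lincomb: "0 \<in> M \<Longrightarrow> 0 \<in> lincomb s M i"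
  by (induction i) force+

lemma lincomb_le:
  assumes "0 \<in> M"
  shows "i \<le> j \<Longrightarrow> lincomb s M i \<subseteq> lincomb s M j"
  by (rule lift_Suc_mono_le[where f = "lincomb s M"]) (use assms lincomb_Suc_subset in blast)+

lemma generator_in_lincomb: "0 \<in> M \<Longrightarrow> g \<in> M \<Longrightarrow> j < i \<Longrightarrow> s j * g \<in> lincomb s M i"
proof -
  assume "0 \<in> M" "g \<in> M" "j < i"
  then have "s j * g \<in> lincomb s M (Suc j)"
    using zero_in_lincomb[of M s j] by force
  then show ?thesis
    using lincomb_le[of M "Suc j" i s] \<open>0 \<in> M\<close> \<open>j < i\<close> by auto
qed

lemma lincomb_UNIV_closed:
  shows "x \<in> lincomb s UNIV i \<Longrightarrow> y \<in> lincomb s UNIV i \<Longrightarrow> x + y \<in> lincomb s UNIV i"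
    and "x \<in> lincomb s UNIV i \<Longrightarrow> r * x \<in> lincomb s UNIV i"
    and "x \<in> lincomb s UNIV i \<Longrightarrow> y \<in> lincomb s UNIV i \<Longrightarrow> x - y \<in> lincomb s UNIV i"
proof -
  show add: "x + y \<in> lincomb s UNIV i" if "x \<in> lincomb s UNIV i" "y \<in> lincomb s UNIV i" for x y
    using that by (rule lincomb_add[rotated]) auto
  show mult: "r * x \<in> lincomb s UNIV i" if "x \<in> lincomb s UNIV i" for r x
    using that by (rule lincomb_mult[rotated]) auto
  show "x \<in> lincomb s UNIV i \<Longrightarrow> y \<in> lincomb s UNIV i \<Longrightarrow> x - y \<in> lincomb s UNIV i"
    using add[of x "- 1 * y"] mult[of y "- 1"] by simp
qed

lemma ideal_typeI:
  fixes K :: "'r::comm_ring_1 set"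
  assumes zero: "0 \<in> K" and add: "\<And>x y. x \<in> K \<Longrightarrow> y \<in> K \<Longrightarrow> x + y \<in> K"
    and mult: "\<And>x r. x \<in> K \<Longrightarrow> r * x \<in> K"
  shows "ideal K ring_of_type_algebra"
proof -
  interpret R: ring "ring_of_type_algebra :: 'r ring"
    by (rule ring_from_type_algebra)
  show ?thesis
  proof (rule idealI[OF R.ring_axioms R.add.subgroupI])
    show "K \<noteq> {}"
      using zero by auto
    show "\<ominus>\<^bsub>ring_of_type_algebra\<^esub> x \<in> K" if "x \<in> K" for x
    proof -
      have "\<ominus>\<^bsub>ring_of_type_algebra\<^esub> x = - x"
        by (rule R.minus_equality) simp_all
      then show ?thesis
        using mult[OF that, of "- 1"] by simp
    qed
    show "x \<otimes>\<^bsub>ring_of_type_algebra\<^esub> r \<in> K" if "x \<in> K" for x r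
      using mult[OF that, of r] by (simp add: mult.commute)
  qed (auto simp: add mult)
qed

lemma ideal_lincomb: "ideal (lincomb s UNIV i) ring_of_type_algebra"
  by (intro ideal_typeI zero_in_lincomb lincomb_UNIV_closed) simp


section \<open>Ideals generated by relative regular sequences\<close>

text \<open>Forms in the variables of the generators \<open>a 0, \<dots>, a (n - 1)\<close> only.  Those of degree \<open>d + 1\<close>
  lying in the ideal of the first \<open>i\<close> variables are \<open>lincomb (\<lambda>j. mvar (a j)) (forms a n d) i\<close>.\<close>

primrec forms :: "(nat \<Rightarrow> 'r::comm_ring_1) \<Rightarrow> nat \<Rightarrow> nat \<Rightarrow> ('r, 'r) mpoly set" where
  "forms a n 0 = range mconst"
| "forms a n (Suc d) = lincomb (\<lambda>i. mvar (a i)) (forms a n d) n"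

text \<open>The powers of the ideal of the generators, as the values of the forms: the recursion follows
  that of \<open>forms\<close>.\<close>

primrec gen_pow :: "(nat \<Rightarrow> 'r::comm_ring_1) \<Rightarrow> nat \<Rightarrow> nat \<Rightarrow> 'r set" where
  "gen_pow a n 0 = UNIV"
| "gen_pow a n (Suc d) = lincomb a (gen_pow a n d) n"

context
  fixes a :: "nat \<Rightarrow> 'r::comm_ring_1" and n :: nat
begin

abbreviation "T i \<equiv> (mvar (a i) :: ('r, 'r) mpoly)"
abbreviation "I \<equiv> lincomb a UNIV n"
abbreviation "L \<equiv> sym_ideal I"
abbreviation "P \<equiv> sym_poly_ring I"

lemma generator_in_I: "i < n \<Longrightarrow> a i \<in> I"
  using generator_in_lincomb[of UNIV 1 i n a] by simp

lemma gen_pow_closed: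
  shows "x \<in> gen_pow a n d \<Longrightarrow> y \<in> gen_pow a n d \<Longrightarrow> x + y \<in> gen_pow a n d"
    and "x \<in> gen_pow a n d \<Longrightarrow> r * x \<in> gen_pow a n d" and "0 \<in> gen_pow a n d"
proof -
  show "x \<in> gen_pow a n d \<Longrightarrow> y \<in> gen_pow a n d \<Longrightarrow> x + y \<in> gen_pow a n d" for x y
    by (induction d arbitrary: x y) (auto intro: lincomb_add)
  show "x \<in> gen_pow a n d \<Longrightarrow> r * x \<in> gen_pow a n d" for x
    by (induction d arbitrary: x) (auto intro: lincomb_mult)
  show "0 \<in> gen_pow a n d"
    by (induction d) (auto intro: zero_in_lincomb)
qed

lemma forms_closed:
  shows "x \<in> forms a n d \<Longrightarrow> y \<in> forms a n d \<Longrightarrow> x + y \<in> forms a n d"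
    and "x \<in> forms a n d \<Longrightarrow> mconst r * x \<in> forms a n d" and "0 \<in> forms a n d"
proof -
  show "x \<in> forms a n d \<Longrightarrow> y \<in> forms a n d \<Longrightarrow> x + y \<in> forms a n d" for x y
    by (induction d arbitrary: x y) (auto intro: lincomb_add simp flip: mconst_simps)
  show "x \<in> forms a n d \<Longrightarrow> mconst r * x \<in> forms a n d" for x
    by (induction d arbitrary: x) (auto intro: lincomb_mult simp flip: mconst_simps)
  show "0 \<in> forms a n d"
    by (induction d) (auto intro: zero_in_lincomb simp: image_iff intro!: exI[of _ 0] simp: mconst_simps)
qed

lemma forms_diff: "x \<in> forms a n d \<Longrightarrow> y \<in> forms a n d \<Longrightarrow> x - y \<in> forms a n d"
  using forms_closed(1)[of x d "mconst (- 1) * y"] forms_closed(2)[of y d "- 1"]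
  by (simp add: mconst_simps)

lemma rees_eval_lincomb:
  assumes "\<And>y. y \<in> F \<Longrightarrow> \<exists>u\<in>U. rees_eval y = monom u d"
  shows "y \<in> lincomb T F i \<Longrightarrow> \<exists>u\<in>lincomb a U i. rees_eval y = monom u (Suc d)"
proof (induction i arbitrary: y)
  case 0
  then show ?case
    by (simp add: rees_eval_zero)
next
  case (Suc i)
  then obtain g h where y: "y = T i * g + h" "g \<in> F" "h \<in> lincomb T F i"
    by auto
  obtain u where u: "u \<in> U" "rees_eval g = monom u d"
    using assms y(2) by blast
  obtain v where v: "v \<in> lincomb a U i" "rees_eval h = monom v (Suc d)"
    using Suc.IH y(3) by blast
  have "rees_eval y = monom (a i * u + v) (Suc d)"
    by (simp add: y(1) u v rees_eval_add rees_eval_mult rees_eval_mvar mult_monom add_monom)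
  then show ?case
    using u v by force
qed

lemma lincomb_lift:
  assumes "\<And>u. u \<in> U \<Longrightarrow> \<exists>y\<in>F. rees_eval y = monom u d"
  shows "u \<in> lincomb a U i \<Longrightarrow> \<exists>y\<in>lincomb T F i. rees_eval y = monom u (Suc d)"
proof (induction i arbitrary: u)
  case 0
  then show ?case
    by (simp add: rees_eval_zero)
next
  case (Suc i)
  then obtain v w where u: "u = a i * v + w" "v \<in> U" "w \<in> lincomb a U i"
    by auto
  obtain g where g: "g \<in> F" "rees_eval g = monom v d"
    using assms u(2) by blast
  obtain h where h: "h \<in> lincomb T F i" "rees_eval h = monom w (Suc d)"
    using Suc.IH u(3) by blast
  have "rees_eval (T i * g + h) = monom u (Suc d)"
    by (simp add: u(1) g h rees_eval_add rees_eval_mult rees_eval_mvar mult_monom add_monom)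
  then show ?case
    using g h by force
qed

lemma rees_eval_forms: "y \<in> forms a n d \<Longrightarrow> \<exists>u\<in>gen_pow a n d. rees_eval y = monom u d"
proof (induction d arbitrary: y)
  case (Suc d)
  then show ?case
    using rees_eval_lincomb[of "forms a n d" "gen_pow a n d" d y n] by simp
qed (auto simp: rees_eval_mconst monom_0)

lemma forms_lift: "u \<in> gen_pow a n d \<Longrightarrow> \<exists>y\<in>forms a n d. rees_eval y = monom u d"
proof (induction d arbitrary: u)
  case (Suc d)
  then show ?case
    using lincomb_lift[of "gen_pow a n d" "forms a n d" d u n] by simp
qed (auto simp: rees_eval_mconst monom_0)

lemma sym_poly_ring_closed:
  shows "p \<in> carrier P \<Longrightarrow> q \<in> carrier P \<Longrightarrow> p + q \<in> carrier P"
    and "p \<in> carrier P \<Longrightarrow> q \<in> carrier P \<Longrightarrow> p * q \<in> carrier P" and "0 \<in> carrier P"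
proof -
  note simps = sym_poly_ring_simps(2-5)[OF ideal_lincomb]
  interpret cring P
    by (rule cring_sym_poly_ring[OF ideal_lincomb])
  show "p \<in> carrier P \<Longrightarrow> q \<in> carrier P \<Longrightarrow> p + q \<in> carrier P"
    "p \<in> carrier P \<Longrightarrow> q \<in> carrier P \<Longrightarrow> p * q \<in> carrier P" "0 \<in> carrier P"
    using a_closed[of p q] m_closed[of p q] zero_closed by (simp_all only: simps)
qed

lemma sym_ideal_closed:
  shows "x \<in> L \<Longrightarrow> y \<in> L \<Longrightarrow> x + y \<in> L" and "x \<in> L \<Longrightarrow> p \<in> carrier P \<Longrightarrow> p * x \<in> L"
    and "0 \<in> L" and "x \<in> L \<Longrightarrow> y \<in> L \<Longrightarrow> x - y \<in> L" and "x \<in> sym_rels I \<Longrightarrow> x \<in> L"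
proof -
  note simps = sym_poly_ring_simps(2-5)[OF ideal_lincomb]
  interpret ideal L P
    by (rule ideal_sym_ideal[OF ideal_lincomb])
  show add: "x \<in> L \<Longrightarrow> y \<in> L \<Longrightarrow> x + y \<in> L" for x y
    using additive_subgroup.a_closed[OF ideal.axioms(1)[OF ideal_sym_ideal[OF ideal_lincomb]], of x a n y]
    by (simp only: simps)
  show mult: "x \<in> L \<Longrightarrow> p \<in> carrier P \<Longrightarrow> p * x \<in> L" for x p
    using I_l_closed[of x p] by (simp only: simps)
  show "0 \<in> L"
    using additive_subgroup.zero_closed[OF ideal.axioms(1)[OF ideal_sym_ideal[OF ideal_lincomb]], of a n]
    by (simp only: simps)
  show "x \<in> L \<Longrightarrow> y \<in> L \<Longrightarrow> x - y \<in> L"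
    using add[of x "mconst (- 1) * y"] mult[of y "mconst (- 1)"]
      mconst_in_sym_poly_ring[OF ideal_lincomb, of "- 1" a n] by (simp add: mconst_simps)
  show "x \<in> sym_rels I \<Longrightarrow> x \<in> L"
    unfolding sym_ideal_def
    using genideal_self[OF sym_rels_subset[OF ideal_lincomb]] by blast
qed

lemma T_in_carrier: "i < n \<Longrightarrow> T i \<in> carrier P"
  by (intro mvar_in_sym_poly_ring ideal_lincomb generator_in_I)

lemma lincomb_in_carrier: "F \<subseteq> carrier P \<Longrightarrow> i \<le> n \<Longrightarrow> lincomb T F i \<subseteq> carrier P"
proof (induction i)
  case (Suc i)
  then show ?case
    using T_in_carrier[of i] by (auto intro!: sym_poly_ring_closed)
qed (simp add: sym_poly_ring_closed)

lemma forms_in_carrier: "forms a n d \<subseteq> carrier P"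
  using mconst_in_sym_poly_ring[OF ideal_lincomb, of _ a n]
  by (induction d) (simp_all add: image_subset_iff lincomb_in_carrier)

lemma mvar_mult_rel: "x \<in> I \<Longrightarrow> mvar (r * x) - mconst r * mvar x \<in> L"
  by (rule sym_ideal_closed(5)) (unfold sym_rels_def, blast)

lemma mvar_add_rel: "x \<in> I \<Longrightarrow> y \<in> I \<Longrightarrow> mvar (x + y) - (mvar x + mvar y) \<in> L"
  by (rule sym_ideal_closed(5)) (unfold sym_rels_def, blast)

lemma mvar_zero: "mvar 0 \<in> L"
  using mvar_mult_rel[of 0 0] zero_in_lincomb[of UNIV a n] by (simp add: mconst_simps)

text \<open>This settles degree one: a linear form is congruent to the variable of its value, and that
  variable is \<open>mvar 0\<close>, a member of \<open>L\<close>, when the value vanishes.\<close>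

lemma linear_form_rel:
  assumes "i \<le> n"
  shows "y \<in> lincomb T (range mconst) i \<Longrightarrow>
    \<exists>u\<in>lincomb a UNIV i. rees_eval y = monom u 1 \<and> mvar u - y \<in> L"
  using assms
proof (induction i arbitrary: y)
  case 0
  then show ?case
    using mvar_zero by (simp add: rees_eval_zero)
next
  case (Suc i)
  then obtain c h where y: "y = T i * mconst c + h" "h \<in> lincomb T (range mconst) i"
    by auto
  obtain v where v: "v \<in> lincomb a UNIV i" "rees_eval h = monom v 1" "mvar v - h \<in> L"
    using Suc y(2) by auto
  have ev: "rees_eval y = monom (c * a i + v) 1"
    by (simp add: y(1) v(2) rees_eval_add rees_eval_mult rees_eval_mvar rees_eval_mconst
        mult_monom add_monom smult_monom mult.commute flip: add_monom)
  have ai: "a i \<in> I" and vI: "v \<in> I"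
    using Suc.prems generator_in_I lincomb_le[of UNIV i n a] v(1) by auto
  have "(mvar (c * a i + v) - (mvar (c * a i) + mvar v)) + (mvar (c * a i) - mconst c * T i)
      + (mvar v - h) \<in> L"
    by (intro sym_ideal_closed(1) mvar_add_rel mvar_mult_rel v(3) ai vI lincomb_UNIV_closed(2))
  then have "mvar (c * a i + v) - y \<in> L"
    by (simp add: y(1) algebra_simps)
  moreover have "c * a i + v \<in> lincomb a UNIV (Suc i)"
    using v(1) by (auto simp: mult.commute)
  ultimately show ?case
    using ev by blast
qed

lemma mvar_linear_form:
  assumes "i \<le> n"
  shows "u \<in> lincomb a UNIV i \<Longrightarrow> \<exists>y\<in>lincomb T (range mconst) i. mvar u - y \<in> L"
proof -
  assume u: "u \<in> lincomb a UNIV i"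
  obtain y where y: "y \<in> lincomb T (range mconst) i" "rees_eval y = monom u (Suc 0)"
    using lincomb_lift[OF _ u, where F = "range mconst" and d = 0]
    by (auto simp: rees_eval_mconst monom_0)
  then show ?thesis
    using linear_form_rel[OF assms y(1)] by (auto simp: monom_eq_iff')
qed

text \<open>The symmetric algebra is presented with a variable for every element of the ideal.  Modulo the
  linear relations each of them is a linear form in the variables of the generators, so forms in
  the latter already represent everything.\<close>

lemma forms_decomposition:
  assumes "p \<in> carrier P"
  shows "\<exists>N y. (\<forall>d. y d \<in> forms a n d) \<and> p - (\<Sum>d<N. y d) \<in> L"
proof -
  have "\<forall>m\<in>Poly_Mapping.keys p. Poly_Mapping.keys m \<subseteq> I"
    using assms sym_poly_ring_simps(1)[OF ideal_lincomb] by blast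
  then show ?thesis
  proof (induction p rule: mpoly_induct_vars)
    case (const c)
    have "mconst c - (\<Sum>d<Suc 0. if d = 0 then mconst c else 0) \<in> L"
      by (simp add: sym_ideal_closed)
    then show ?case
      using forms_closed(3) by (intro exI[of _ "Suc 0"] exI[of _ "\<lambda>d. if d = 0 then mconst c else 0"]) auto
  next
    case (add p q)
    then obtain N y M z where y: "\<forall>d. y d \<in> forms a n d" "p - (\<Sum>d<N. y d) \<in> L"
      and z: "\<forall>d. z d \<in> forms a n d" "q - (\<Sum>d<M. z d) \<in> L"
      by blast
    define w where "w d = (if d < N then y d else 0) + (if d < M then z d else 0)" for d
    have "(\<Sum>d<max N M. w d) = (\<Sum>d<N. y d) + (\<Sum>d<M. z d)"
      unfolding w_def sum.distrib
      by (intro arg_cong2[where f = "(+)"] sum.mono_neutral_cong_right) auto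
    then have "p + q - (\<Sum>d<max N M. w d) = (p - (\<Sum>d<N. y d)) + (q - (\<Sum>d<M. z d))"
      by simp
    also have "\<dots> \<in> L"
      using y z by (intro sym_ideal_closed(1)) auto
    finally show ?case
      using y z by (intro exI[of _ "max N M"] exI[of _ w]) (auto simp: w_def forms_closed)
  next
    case (mult_var v p)
    then obtain N y where y: "\<forall>d. y d \<in> forms a n d" "p - (\<Sum>d<N. y d) \<in> L"
      by blast
    obtain l where l: "l \<in> lincomb T (range mconst) n" "mvar v - l \<in> L"
      using mvar_linear_form[of n v] mult_var by auto
    have ly: "y d * l \<in> lincomb T (forms a n d) n" for d
      by (rule lincomb_mult[OF _ l(1)]) (use y(1) in \<open>auto simp: mult.commute[of "y d"] forms_closed\<close>)
    define w where "w d = (case d of 0 \<Rightarrow> 0 | Suc d \<Rightarrow> y d * l)" for d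
    have w: "w d \<in> forms a n d" for d
      using ly forms_closed(3)[of d] by (cases d) (simp_all add: w_def)
    have lin: "l \<in> carrier P"
      using l(1) lincomb_in_carrier[OF forms_in_carrier[of 0], of n] by auto
    have yc: "(\<Sum>d<N. y d) \<in> carrier P"
      using y(1) forms_in_carrier sym_poly_ring_closed
      by (induction N) (simp_all, meson subsetD)
    have "(\<Sum>d<Suc N. w d) = l * (\<Sum>d<N. y d)"
      by (simp add: sum.lessThan_Suc_shift w_def sum_distrib_left mult.commute del: sum.lessThan_Suc)
    then have "mvar v * p - (\<Sum>d<Suc N. w d)
        = mvar v * (p - (\<Sum>d<N. y d)) + (\<Sum>d<N. y d) * (mvar v - l)"
      by (simp add: algebra_simps)
    also have "\<dots> \<in> L"
      using mult_var(1) y(2) l(2) yc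
      by (intro sym_ideal_closed(1,2) mvar_in_sym_poly_ring[OF ideal_lincomb]) auto
    finally show ?case
      using w by blast
  qed
qed

context
  assumes relative_regular:
    "\<And>i u. i < n \<Longrightarrow> u \<in> I \<Longrightarrow> a i * u \<in> lincomb a UNIV i \<Longrightarrow> u \<in> lincomb a UNIV i"
begin

lemma gen_pow_Suc_subset: "gen_pow a n (Suc d) \<subseteq> I"
  using lincomb_mono[of "gen_pow a n d" UNIV a n] by simp

text \<open>Descending induction on \<open>i\<close>, the case \<open>i = n\<close> being the definition of the power.  In a
  representation $u = a_i y + v$ with $y \<in> I^{d+1}$ the condition on the sequence gives
  $y \<in> (a_0,\ldots,a_{i-1})$, and the induction on the exponent then
  $y \<in> (a_0,\ldots,a_{i-1}) I^d$; this absorbs the factor $a_i$.\<close>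

lemma artin_rees:
  assumes "i \<le> n" "u \<in> lincomb a UNIV i" "u \<in> gen_pow a n (Suc d)"
  shows "u \<in> lincomb a (gen_pow a n d) i"
  using assms
proof (induction d arbitrary: i u)
  case 0
  then show ?case
    by simp
next
  case (Suc d)
  from Suc.prems show ?case
  proof (induction i arbitrary: u rule: inc_induct)
    case base
    then show ?case
      by simp
  next
    case (step i)
    have "u \<in> lincomb a (gen_pow a n (Suc d)) (Suc i)"
      using step lincomb_Suc_subset[of UNIV a i] by blast
    then obtain y v where u: "u = a i * y + v" "y \<in> gen_pow a n (Suc d)"
      "v \<in> lincomb a (gen_pow a n (Suc d)) i"
      by auto
    have "a i * y = u - v"
      using u by simp
    also have "\<dots> \<in> lincomb a UNIV i"
      using step u(3) lincomb_mono[of _ UNIV a i] by (blast intro: lincomb_UNIV_closed)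
    finally have "y \<in> lincomb a UNIV i"
      using relative_regular step(2) u(2) gen_pow_Suc_subset by blast
    then have "y \<in> lincomb a (gen_pow a n d) i"
      using Suc.IH[of i y] step u by auto
    then have "a i * y \<in> lincomb a (gen_pow a n (Suc d)) i"
      by (rule lincomb_mult[rotated])
         (use generator_in_lincomb[of "gen_pow a n d" _ i n a] gen_pow_closed step in auto)
    from lincomb_add[OF gen_pow_closed(1) this u(3)] show ?case
      unfolding u(1) .
  qed
qed

text \<open>The leading variable of a vanishing form $T_i g + h$ is traded for smaller ones: the value of
  \<open>g\<close> is also the value of a form \<open>g'\<close> in the ideal of the smaller variables, and \<open>g - g'\<close> is a
  vanishing form of lower degree.  Degree one is exactly what the linear relations provide, and
  it has to be treated separately because a form of degree zero has no value in the ideal.\<close>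

lemma form_relation_in_sym_ideal:
  assumes "y \<in> forms a n d" "rees_eval y = 0"
  shows "y \<in> L"
  using assms
proof (induction d arbitrary: y)
  case 0
  then show ?case
    by (auto simp: rees_eval_mconst mconst_simps sym_ideal_closed)
next
  case (Suc d)
  show ?case
  proof (cases d)
    case 0
    then obtain u where "rees_eval y = monom u 1" "mvar u - y \<in> L"
      using linear_form_rel[of n y] Suc.prems by auto
    then have "mvar 0 - y \<in> L"
      using Suc.prems by auto
    from sym_ideal_closed(4)[OF mvar_zero this] show ?thesis
      by simp
  next
    case (Suc e)
    have "y \<in> L" if "i \<le> n" "y \<in> lincomb T (forms a n d) i" "rees_eval y = 0" for i y
      using that
    proof (induction i arbitrary: y)
      case 0
      then show ?case
        by (simp add: sym_ideal_closed)
    next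
      case (Suc i)
      then obtain g h where y: "y = T i * g + h" "g \<in> forms a n d" "h \<in> lincomb T (forms a n d) i"
        by auto
      obtain u where u: "u \<in> gen_pow a n d" "rees_eval g = monom u d"
        using rees_eval_forms y(2) by blast
      obtain v where v: "v \<in> lincomb a (gen_pow a n d) i" "rees_eval h = monom v (Suc d)"
        using rees_eval_lincomb[OF rees_eval_forms y(3)] by blast
      have "a i * u + v = 0"
        using Suc.prems(3)
        by (simp add: y(1) u v rees_eval_add rees_eval_mult rees_eval_mvar mult_monom add_monom)
      then have "a i * u = - 1 * v"
        by (simp add: eq_neg_iff_add_eq_0)
      also have "\<dots> \<in> lincomb a UNIV i"
        using v(1) lincomb_mono[of _ UNIV a i] by (blast intro: lincomb_UNIV_closed)
      finally have "u \<in> lincomb a UNIV i"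
        using relative_regular[of i u] u(1) gen_pow_Suc_subset[of e] Suc.prems(1) \<open>d = Suc e\<close> by auto
      then have "u \<in> lincomb a (gen_pow a n e) i"
        using artin_rees[of i u e] u(1) Suc.prems(1) \<open>d = Suc e\<close> by auto
      then obtain g' where g': "g' \<in> lincomb T (forms a n e) i" "rees_eval g' = monom u d"
        using lincomb_lift[OF forms_lift] \<open>d = Suc e\<close> by blast
      have "g' \<in> forms a n d"
        using g'(1) lincomb_le[of "forms a n e" i n T] forms_closed(3) Suc.prems(1) \<open>d = Suc e\<close> by auto
      then have "g - g' \<in> L"
        using y(2) u(2) g'(2) by (intro \<open>\<And>y. y \<in> forms a n d \<Longrightarrow> rees_eval y = 0 \<Longrightarrow> y \<in> L\<close>)
          (simp_all add: forms_diff rees_eval_diff)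
      then have Tg: "T i * (g - g') \<in> L"
        using Suc.prems(1) by (intro sym_ideal_closed(2) T_in_carrier) auto
      have "T i * g' \<in> lincomb T (forms a n d) i"
        using g'(1) generator_in_lincomb[of "forms a n e" _ i n T] forms_closed Suc.prems(1) \<open>d = Suc e\<close>
        by (intro lincomb_mult) auto
      then have "T i * g' + h \<in> lincomb T (forms a n d) i"
        using y(3) by (intro lincomb_add) (auto simp: forms_closed)
      moreover have "rees_eval (T i * g' + h) = 0"
        using Suc.prems(3) u(2) g'(2) by (simp add: y(1) rees_eval_add rees_eval_mult)
      ultimately have "T i * g' + h \<in> L"
        using Suc.IH Suc.prems(1) by auto
      from sym_ideal_closed(1)[OF Tg this] show ?case
        by (simp add: y(1) algebra_simps)
    qed
    from this[of n y] show ?thesis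
      using Suc.prems by simp
  qed
qed

text \<open>The Rees algebra is graded, so a vanishing sum of forms of distinct degrees has vanishing
  summands.\<close>

theorem relative_regular_sequence_linear_type: "linear_type I"
proof -
  have kernel: "p \<in> L" if p: "p \<in> carrier P" "rees_eval p = 0" for p
  proof -
    obtain N y where y: "\<And>d. y d \<in> forms a n d" "p - (\<Sum>d<N. y d) \<in> L"
      using forms_decomposition[OF p(1)] by blast
    have "\<forall>d. \<exists>u. rees_eval (y d) = monom u d"
      using rees_eval_forms y(1) by blast
    then obtain u where u: "\<And>d. rees_eval (y d) = monom (u d) d"
      by metis
    have "rees_eval (\<Sum>d<N. y d) = 0"
      using rees_eval_sym_ideal[OF ideal_lincomb y(2)] p(2) by (simp add: rees_eval_diff)
    then have sum0: "(\<Sum>d<N. monom (u d) d) = 0"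
      by (simp add: rees_eval_sum u)
    have "y d \<in> L" if "d < N" for d
    proof (rule form_relation_in_sym_ideal[OF y(1)])
      have "coeff (\<Sum>d<N. monom (u d) d) d = u d"
        using that by (simp add: coeff_sum sum.delta)
      then show "rees_eval (y d) = 0"
        using sum0 by (simp add: u)
    qed
    then have "(\<Sum>d<N. y d) \<in> L"
      by (induction N) (simp_all add: sym_ideal_closed)
    from sym_ideal_closed(1)[OF y(2) this] show ?thesis
      by simp
  qed
  interpret ideal L P
    by (rule ideal_sym_ideal[OF ideal_lincomb])
  show ?thesis
    unfolding linear_type_def
  proof (rule inj_onI)
    fix C D
    assume "C \<in> carrier (sym_algebra I)" "D \<in> carrier (sym_algebra I)" "sym_to_rees C = sym_to_rees D"
    then obtain p q where pq: "p \<in> carrier P" "q \<in> carrier P" "C = L +>\<^bsub>P\<^esub> p" "D = L +>\<^bsub>P\<^esub> q"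
      by (metis sym_algebra_carrierE[OF ideal_lincomb])
    then have "rees_eval (p - q) = 0"
      using \<open>sym_to_rees C = _\<close> by (simp add: sym_to_rees_coset[OF ideal_lincomb] rees_eval_diff)
    then have "p - q \<in> L"
      using kernel sym_poly_ring_diff[OF ideal_lincomb] pq by blast
    then have "(p - q) \<oplus>\<^bsub>P\<^esub> q \<in> L +>\<^bsub>P\<^esub> q"
      unfolding a_r_coset_def' by blast
    then have "p \<in> L +>\<^bsub>P\<^esub> q"
      by (simp only: sym_poly_ring_simps(3)[OF ideal_lincomb] diff_add_cancel)
    then show "C = D"
      using pq a_repr_independence[OF \<open>p \<in> L +>\<^bsub>P\<^esub> q\<close> pq(2) a_subgroup] by simp
  qed
qed

end

end

section \<open>Kernels of substitutions\<close>

abbreviation subst :: "('x \<Rightarrow> ('y, 'k) mpoly) \<Rightarrow> ('x, 'k::comm_ring_1) mpoly \<Rightarrow> ('y, 'k) mpoly" where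
  "subst \<equiv> meval mconst"

lemma subst_simps:
  fixes f :: "'x \<Rightarrow> ('y, 'k::comm_ring_1) mpoly"
  shows "subst f (p + q) = subst f p + subst f q" "subst f (p - q) = subst f p - subst f q"
    "subst f (- p) = - subst f p" "subst f (p * q) = subst f p * subst f q"
    "subst f 0 = 0" "subst f 1 = 1" "subst f (mvar v) = f v" "subst f (mconst c) = mconst c"
    "subst f (sum g A) = (\<Sum>x\<in>A. subst f (g x))"
  by (intro meval_add meval_diff meval_uminus meval_mult meval_zero meval_one meval_mvar
      meval_mconst meval_sum mconst_simps)+

lemma subst_power: "subst f (p ^ n) = subst f p ^ n"
  by (induction n) (simp_all add: subst_simps)

lemma mconst_nonzero: "c \<noteq> 0 \<Longrightarrow> mconst c \<noteq> 0"
  unfolding mconst_def by (metis lookup_single_eq lookup_zero)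

lemma mvar_nonzero: "mvar v \<noteq> (0 :: ('x, 'k::{comm_ring_1, zero_neq_one}) mpoly)"
  unfolding mvar_def by (metis lookup_single_eq lookup_zero zero_neq_one)

lemma mconst_numeral: "mconst (numeral n) = numeral n"
proof -
  have "mconst (of_nat k) = of_nat k" for k
    by (induction k) (simp_all add: mconst_simps)
  from this[of "numeral n"] show ?thesis
    by simp
qed

lemma mconst_power: "mconst (c ^ n) = mconst c ^ n"
  by (induction n) (simp_all add: mconst_simps)

lemma subst_numeral: "subst f (numeral n) = numeral n"
  by (simp add: subst_simps flip: mconst_numeral)

lemma mvar_power: "mvar v ^ n = Poly_Mapping.single (Poly_Mapping.single v n) 1"
  by (induction n) (simp_all add: mvar_def mult_single flip: single_add single_one)

text \<open>The \<open>k\<close>-linear span of the \<open>b n\<close>, plus \<open>K\<close>.  It is an ideal as soon as every product of a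
  variable with some \<open>b n\<close> is, modulo \<open>K\<close>, a multiple of some \<open>b n'\<close>.\<close>

definition span_mod :: "'n set \<Rightarrow> ('n \<Rightarrow> ('x, 'k::comm_ring_1) mpoly) \<Rightarrow> ('x, 'k) mpoly set
    \<Rightarrow> ('x, 'k) mpoly set" where
  "span_mod N b K =
     {u. \<exists>c F. finite F \<and> F \<subseteq> N \<and> u - (\<Sum>n\<in>F. mconst (c n) * b n) \<in> K}"

context
  fixes N :: "'n set" and b :: "'n \<Rightarrow> ('x, 'k::comm_ring_1) mpoly" and K :: "('x, 'k) mpoly set"
  assumes K: "ideal K ring_of_type_algebra"
    and step: "\<And>n v. n \<in> N \<Longrightarrow> \<exists>c. \<exists>n'\<in>N. mvar v * b n - mconst c * b n' \<in> K"
begin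

lemma span_mod_ideal: "u \<in> K \<Longrightarrow> u \<in> span_mod N b K"
  by (force simp: span_mod_def intro: exI[of _ "{}"])

lemma span_mod_basis: "n \<in> N \<Longrightarrow> mconst c * b n \<in> span_mod N b K"
  unfolding span_mod_def
  by (intro CollectI exI[of _ "\<lambda>_. c"] exI[of _ "{n}"]) (simp add: ideal_type_closed(1)[OF K])

lemma span_mod_add:
  assumes "u \<in> span_mod N b K" "v \<in> span_mod N b K"
  shows "u + v \<in> span_mod N b K"
proof -
  from assms obtain c F d G
    where F: "finite F" "F \<subseteq> N" "u - (\<Sum>n\<in>F. mconst (c n) * b n) \<in> K"
      and G: "finite G" "G \<subseteq> N" "v - (\<Sum>n\<in>G. mconst (d n) * b n) \<in> K"
    unfolding span_mod_def by blast
  define e where "e n = (if n \<in> F then c n else 0) + (if n \<in> G then d n else 0)" for n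
  have "(\<Sum>n\<in>F \<union> G. mconst (e n) * b n)
      = (\<Sum>n\<in>F \<union> G. mconst (if n \<in> F then c n else 0) * b n)
        + (\<Sum>n\<in>F \<union> G. mconst (if n \<in> G then d n else 0) * b n)"
    by (simp add: e_def mconst_simps distrib_right sum.distrib)
  also have "\<dots> = (\<Sum>n\<in>F. mconst (c n) * b n) + (\<Sum>n\<in>G. mconst (d n) * b n)"
    using F(1) G(1)
    by (intro arg_cong2[where f = "(+)"] sum.mono_neutral_cong_right) (auto simp: mconst_simps)
  finally have "u + v - (\<Sum>n\<in>F \<union> G. mconst (e n) * b n)
      = (u - (\<Sum>n\<in>F. mconst (c n) * b n)) + (v - (\<Sum>n\<in>G. mconst (d n) * b n))"
    by simp
  also have "\<dots> \<in> K"
    by (rule ideal_type_closed(2)[OF K F(3) G(3)])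
  finally show ?thesis
    using F G unfolding span_mod_def by blast
qed

lemma span_mod_sum:
  "finite F \<Longrightarrow> (\<And>n. n \<in> F \<Longrightarrow> g n \<in> span_mod N b K) \<Longrightarrow> sum g F \<in> span_mod N b K"
  by (induction F rule: finite_induct)
     (auto intro: span_mod_add span_mod_ideal ideal_type_closed(1)[OF K])

lemma span_mod_mult: "u \<in> span_mod N b K \<Longrightarrow> p * u \<in> span_mod N b K"
proof -
  have const: "mconst r * u \<in> span_mod N b K" if "u \<in> span_mod N b K" for r u
  proof -
    from that obtain c F where F: "finite F" "F \<subseteq> N" "u - (\<Sum>n\<in>F. mconst (c n) * b n) \<in> K"
      unfolding span_mod_def by blast
    have "mconst r * u - (\<Sum>n\<in>F. mconst (r * c n) * b n)
        = mconst r * (u - (\<Sum>n\<in>F. mconst (c n) * b n))"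
      by (simp add: mconst_simps sum_distrib_left right_diff_distrib mult.assoc)
    also have "\<dots> \<in> K"
      by (rule ideal_type_closed(3)[OF K F(3)])
    finally show ?thesis
      using F unfolding span_mod_def by (auto intro!: exI[of _ "\<lambda>n. r * c n"])
  qed
  have var: "mvar v * u \<in> span_mod N b K" if "u \<in> span_mod N b K" for v u
  proof -
    from that obtain c F where F: "finite F" "F \<subseteq> N" "u - (\<Sum>n\<in>F. mconst (c n) * b n) \<in> K"
      unfolding span_mod_def by blast
    have "mvar v * (mconst (c n) * b n) \<in> span_mod N b K" if "n \<in> F" for n
    proof -
      obtain d n' where n': "n' \<in> N" "mvar v * b n - mconst d * b n' \<in> K"
        using step F(2) \<open>n \<in> F\<close> by blast
      have "mconst (c n) * ((mvar v * b n - mconst d * b n') + mconst d * b n') \<in> span_mod N b K"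
        by (intro const span_mod_add span_mod_ideal span_mod_basis n')
      then show ?thesis
        by (simp add: mult.left_commute)
    qed
    then have "(\<Sum>n\<in>F. mvar v * (mconst (c n) * b n)) \<in> span_mod N b K"
      using F(1) by (intro span_mod_sum)
    then have "mvar v * (u - (\<Sum>n\<in>F. mconst (c n) * b n))
        + (\<Sum>n\<in>F. mvar v * (mconst (c n) * b n)) \<in> span_mod N b K"
      by (rule span_mod_add[OF span_mod_ideal[OF ideal_type_closed(3)[OF K F(3)]]])
    then show ?thesis
      by (simp add: right_diff_distrib sum_distrib_left)
  qed
  assume u: "u \<in> span_mod N b K"
  have "\<forall>m\<in>Poly_Mapping.keys p. Poly_Mapping.keys m \<subseteq> UNIV"
    by simp
  then show ?thesis
    by (induction p rule: mpoly_induct_vars)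
       (auto simp: distrib_right mult.assoc intro: const u span_mod_add var)
qed

end

text \<open>The \<open>b n\<close> are sent to nonzero multiples of distinct monomials and so stay linearly independent:
  a combination of them that is killed by the substitution is trivial.\<close>

lemma subst_kernel:
  fixes b :: "'n \<Rightarrow> ('x, 'k::idom) mpoly" and f :: "'x \<Rightarrow> ('y, 'k) mpoly"
  assumes K: "ideal K ring_of_type_algebra"
    and vanish: "\<And>u. u \<in> K \<Longrightarrow> subst f u = 0"
    and monomial: "\<And>n. n \<in> N \<Longrightarrow> subst f (b n) = Poly_Mapping.single (E n) (w n)"
    and nonzero: "\<And>n. n \<in> N \<Longrightarrow> w n \<noteq> 0"
    and inj: "inj_on E N"
    and u: "u \<in> span_mod N b K" "subst f u = 0"
  shows "u \<in> K"
proof -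
  from u(1) obtain c F where F: "finite F" "F \<subseteq> N" "u - (\<Sum>n\<in>F. mconst (c n) * b n) \<in> K"
    unfolding span_mod_def by blast
  have "(\<Sum>n\<in>F. Poly_Mapping.single (E n) (c n * w n)) = subst f (\<Sum>n\<in>F. mconst (c n) * b n)"
    using F(2) unfolding subst_simps
    by (intro sum.cong) (auto simp: monomial mconst_def mult_single)
  also have "\<dots> = 0"
    using vanish[OF F(3)] u(2) by (simp add: subst_simps)
  finally have sum0: "(\<Sum>n\<in>F. Poly_Mapping.single (E n) (c n * w n)) = 0" .
  have "c n = 0" if n: "n \<in> F" for n
  proof -
    have "c n * w n = (\<Sum>m\<in>F. if m = n then c m * w m else 0)"
      using F(1) n by simp
    also have "\<dots> = (\<Sum>m\<in>F. Poly_Mapping.lookup (Poly_Mapping.single (E m) (c m * w m)) (E n))"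
      using inj F(2) n
      by (intro sum.cong) (auto simp: lookup_single when_def inj_on_def)
    also have "\<dots> = 0"
      using arg_cong[OF sum0, of "\<lambda>p. Poly_Mapping.lookup p (E n)"] by (simp add: lookup_sum)
    finally show ?thesis
      using nonzero n F(2) by auto
  qed
  then show ?thesis
    using F(3) by (simp add: mconst_simps)
qed

lemma exact_step:
  fixes b :: "'n \<Rightarrow> ('x, 'k::comm_ring_1) mpoly"
  assumes "ideal K ring_of_type_algebra" "n' \<in> N" "p = b n'"
  shows "\<exists>c. \<exists>n'\<in>N. p - mconst c * b n' \<in> K"
  using assms by (intro exI[of _ 1] bexI[of _ n']) (auto simp: mconst_simps ideal_type_closed)

text \<open>A substitution that is the identity modulo \<open>K\<close> on the variables is so on all polynomials.\<close>

lemma subst_congruent: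
  fixes f :: "'x \<Rightarrow> ('x, 'k::comm_ring_1) mpoly"
  assumes K: "ideal K ring_of_type_algebra" and var: "\<And>v. mvar v - f v \<in> K"
  shows "p - subst f p \<in> K"
proof -
  have "\<forall>m\<in>Poly_Mapping.keys p. Poly_Mapping.keys m \<subseteq> UNIV"
    by simp
  then show ?thesis
  proof (induction p rule: mpoly_induct_vars)
    case (const c)
    then show ?case
      by (simp add: subst_simps ideal_type_closed(1)[OF K])
  next
    case (add p q)
    from ideal_type_closed(2)[OF K this] show ?case
      by (simp add: subst_simps algebra_simps)
  next
    case (mult_var v p)
    have "mvar v * (p - subst f p) + subst f p * (mvar v - f v) \<in> K"
      by (intro ideal_type_closed[OF K] var mult_var)
    then show ?case
      by (simp add: subst_simps algebra_simps)
  qed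
qed


section \<open>The gradient of the Hankel determinant\<close>

lemma exhaust_5:
  fixes v :: 5
  shows "v = 0 \<or> v = 1 \<or> v = 2 \<or> v = 3 \<or> v = 4"
proof (induct v)
  case (of_int z)
  then have "0 \<le> z" "z < 5"
    by simp_all
  then have "z = 0 \<or> z = 1 \<or> z = 2 \<or> z = 3 \<or> z = 4"
    by arith
  then show ?case
    by auto
qed

lemma mpderiv_superset:
  assumes "finite A" "Poly_Mapping.keys p \<subseteq> A"
  shows "mpderiv i p = (\<Sum>m\<in>A. Poly_Mapping.single (m - Poly_Mapping.single i 1)
    (of_nat (Poly_Mapping.lookup m i) * Poly_Mapping.lookup p m))"
  unfolding mpderiv_def using assms
  by (intro sum.mono_neutral_left) (auto simp: in_keys_iff)

lemma mpderiv_single: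
  "mpderiv i (Poly_Mapping.single m c)
    = Poly_Mapping.single (m - Poly_Mapping.single i 1) (of_nat (Poly_Mapping.lookup m i) * c)"
  by (subst mpderiv_superset[of "{m}"]) auto

lemma mpderiv_add: "mpderiv i (p + q) = mpderiv i p + mpderiv i q"
proof -
  let ?A = "Poly_Mapping.keys p \<union> Poly_Mapping.keys q"
  show ?thesis
    using mpderiv_superset[of ?A p i] mpderiv_superset[of ?A q i] mpderiv_superset[of ?A "p + q" i]
      Poly_Mapping.keys_add[of p q]
    by (simp add: lookup_add distrib_left single_add sum.distrib)
qed

lemma mpderiv_diff: "mpderiv i (p - q) = mpderiv i p - mpderiv i q"
  using mpderiv_add[of i "p - q" q] by (simp add: algebra_simps)

text \<open>The Leibniz rule in the case of a variable as first factor, which suffices to differentiate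
  a polynomial written as a sum of products of variables.\<close>

lemma mpderiv_mvar_mult: "mpderiv i (mvar j * p) = (if i = j then p else 0) + mvar j * mpderiv i p"
proof -
  have single: "mpderiv i (mvar j * Poly_Mapping.single m c)
      = (if i = j then Poly_Mapping.single m c else 0) + mvar j * mpderiv i (Poly_Mapping.single m c)"
    for m and c :: 'b
  proof (cases "i = j")
    case False
    have "Poly_Mapping.single j 1 + m - Poly_Mapping.single i 1
        = Poly_Mapping.single j (1::nat) + (m - Poly_Mapping.single i 1)"
      using False by (intro poly_mapping_eqI) (auto simp: lookup_add lookup_minus lookup_single when_def)
    then show ?thesis
      using False by (simp add: mvar_times_single mpderiv_single lookup_add lookup_single
          del: One_nat_def)
  next
    case True
    show ?thesis
    proof (cases "Poly_Mapping.lookup m j = 0")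
      case True
      then show ?thesis
        using \<open>i = j\<close>
        by (simp add: mvar_times_single mpderiv_single lookup_add lookup_single del: One_nat_def)
    next
      case False
      then have "Poly_Mapping.single j 1 + (m - Poly_Mapping.single j 1) = m"
        by (intro poly_mapping_eqI) (auto simp: lookup_add lookup_minus lookup_single when_def)
      then show ?thesis
        using \<open>i = j\<close>
        by (simp add: mvar_times_single mpderiv_single lookup_add lookup_single distrib_right
            single_add del: One_nat_def)
    qed
  qed
  have "mpderiv i (mvar j * (\<Sum>m\<in>M. Poly_Mapping.single m (Poly_Mapping.lookup p m)))
      = (if i = j then (\<Sum>m\<in>M. Poly_Mapping.single m (Poly_Mapping.lookup p m)) else 0)
        + mvar j * mpderiv i (\<Sum>m\<in>M. Poly_Mapping.single m (Poly_Mapping.lookup p m))"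
    if "finite M" for M
    using that
  proof (induction M rule: finite_induct)
    case empty
    then show ?case
      by (simp add: mpderiv_def)
  next
    case (insert m M)
    then show ?case
      by (simp add: distrib_left mpderiv_add single)
  qed
  from this[of "Poly_Mapping.keys p"] show ?thesis
    by (simp add: mpoly_sum_monomials)
qed

lemma mpderiv_mvar: "mpderiv i (mvar j :: ('x, 'a::comm_ring_1) mpoly) = (if i = j then 1 else 0)"
  using mpderiv_mvar_mult[of i j "1 :: ('x, 'a) mpoly"] mpderiv_single[of i 0 "1 :: 'a"]
  by (simp split: if_splits)

abbreviation "x0 \<equiv> (mvar 0 :: (5, 'k::field_char_0) mpoly)"
abbreviation "x1 \<equiv> (mvar 1 :: (5, 'k::field_char_0) mpoly)"
abbreviation "x2 \<equiv> (mvar 2 :: (5, 'k::field_char_0) mpoly)"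
abbreviation "x3 \<equiv> (mvar 3 :: (5, 'k::field_char_0) mpoly)"
abbreviation "x4 \<equiv> (mvar 4 :: (5, 'k::field_char_0) mpoly)"

lemma det_hankel3:
  "det (hankel3 :: (5, 'k::field_char_0) mpoly ^ 3 ^ 3) =
    x0 * (x2 * x4) - x0 * (x3 * x3) - x1 * (x1 * x4) + x1 * (x2 * x3) + x1 * (x2 * x3)
      - x2 * (x2 * x2)"
  by (simp add: det_3 hankel3_def vector_3 algebra_simps)

definition "minor_p = x2 * x3 - x1 * x4"
definition "minor_q = x1 * x2 - x0 * x3"

text \<open>The order of the generators matters, and so does the choice of the fourth one.  On the residual
  curve $(1, t, t^2, -3t^3, 9t^4)$, \<open>minor_p\<close> vanishes to order 5 at $t = 0$ and to order 3 at infinity,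
  and \<open>minor_q\<close> the other way round.  Their combination \<open>minor_p + 3 * minor_q\<close> has the smaller order
  3 at both points, where the residual curve meets the rational normal curve; its
  remaining zeros $t = \pm 1$ are rational thanks to the coefficient 3.\<close>

definition hankel_gen :: "nat \<Rightarrow> (5, 'k::field_char_0) mpoly" where
  "hankel_gen i = [x2 * x4 - x3 * x3, x0 * x2 - x1 * x1, x0 * x4 + 2 * x1 * x3 - 3 * x2 * x2,
     minor_p + 3 * minor_q, minor_q] ! i"

lemma hankel_gen_simps:
  "hankel_gen 0 = x2 * x4 - x3 * x3"
  "hankel_gen (Suc 0) = x0 * x2 - x1 * x1"
  "hankel_gen (Suc (Suc 0)) = x0 * x4 + 2 * x1 * x3 - 3 * x2 * x2"
  "hankel_gen (Suc (Suc (Suc 0))) = minor_p + 3 * minor_q"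
  "hankel_gen (Suc (Suc (Suc (Suc 0)))) = minor_q"
  by (simp_all add: hankel_gen_def)

text \<open>Up to scalars the partial derivatives are $a_0$, $p$, $a_2$, $q$ and $a_1$; the scalar 2 in front
  of \<open>minor_p\<close> and \<open>minor_q\<close> is invertible.\<close>

lemma gradient_ideal_hankel:
  "gradient_ideal (det (hankel3 :: (5, 'k::field_char_0) mpoly ^ 3 ^ 3)) = lincomb hankel_gen UNIV 5"
proof
  let ?R = "ring_of_type_algebra :: (5, 'k::field_char_0) mpoly ring"
  let ?J = "gradient_ideal (det hankel3 :: (5, 'k) mpoly)"
  let ?I = "lincomb hankel_gen UNIV 5 :: (5, 'k) mpoly set"
  interpret R: ring ?R
    by (rule ring_from_type_algebra)
  have partials:
    "mpderiv 0 (det hankel3) = hankel_gen 0"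
    "mpderiv 1 (det hankel3) = 2 * minor_p"
    "mpderiv 2 (det hankel3) = hankel_gen 2"
    "mpderiv 3 (det hankel3) = 2 * minor_q"
    "mpderiv 4 (det hankel3) = hankel_gen 1"
    by (simp_all only: det_hankel3 mpderiv_add mpderiv_diff mpderiv_mvar_mult mpderiv_mvar)
       (simp_all add: hankel_gen_def minor_p_def minor_q_def algebra_simps)
  have gen: "hankel_gen j \<in> ?I" if "j < 5" for j
    using generator_in_lincomb[of UNIV 1 j 5 hankel_gen] that by simp
  note I = lincomb_UNIV_closed
  have q: "minor_q \<in> ?I"
    using gen[of 4] by (simp add: hankel_gen_def)
  have "hankel_gen 3 - 3 * hankel_gen 4 \<in> ?I"
    by (intro I(2,3) gen) simp_all
  then have p: "minor_p \<in> ?I"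
    by (simp add: hankel_gen_def)
  have "mpderiv v (det hankel3) \<in> ?I" for v :: 5
    using exhaust_5[of v] gen[of 0] gen[of 1] gen[of 2] I(2)[OF p] I(2)[OF q]
    by (auto simp: partials)
  then show "?J \<subseteq> ?I"
    unfolding gradient_ideal_def by (intro R.genideal_minimal ideal_lincomb) auto
  have J: "ideal ?J ?R"
    by (rule ideal_gradient_ideal)
  note J_closed = ideal_type_closed[OF J]
  have partial_J: "mpderiv v (det hankel3) \<in> ?J" for v :: 5
    unfolding gradient_ideal_def by (rule R.genideal_self[THEN subsetD]) auto
  have half: "x \<in> ?J" if "2 * x \<in> ?J" for x
  proof -
    have "mconst (1 / 2) * (2 :: (5, 'k) mpoly) = 1"
      unfolding mconst_numeral[symmetric] mconst_simps(4)[symmetric] by (simp add: mconst_simps)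
    then show ?thesis
      using J_closed(3)[OF that, of "mconst (1 / 2)"] by (simp flip: mult.assoc)
  qed
  have pq: "minor_p \<in> ?J" "minor_q \<in> ?J"
    using partial_J[of 1] partial_J[of 3] by (simp_all add: partials half)
  have gen_J: "hankel_gen j \<in> ?J" if "j < 5" for j
  proof -
    have "j = 0 \<or> j = 1 \<or> j = 2 \<or> j = 3 \<or> j = 4"
      using that by arith
    then show ?thesis
      using partial_J[of 0] partial_J[of 4] partial_J[of 2] J_closed(2)[OF pq(1) J_closed(3)[OF pq(2)], of 3] pq(2)
      by (auto simp: partials hankel_gen_def simp del: One_nat_def)
  qed
  have "lincomb hankel_gen UNIV i \<subseteq> ?J" if "i \<le> 5" for i
    using that
  proof (induction i)
    case (Suc i)
    then show ?case
      using J_closed(3)[OF gen_J[of i]] by (auto intro!: J_closed(2) simp: mult.commute)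
  qed (simp add: J_closed)
  then show "?I \<subseteq> ?J"
    by simp
qed


section \<open>Two quadrics as kernels of monomial substitutions\<close>

lemma lincomb_intros:
  "x = s 0 * g \<Longrightarrow> x \<in> lincomb s UNIV (Suc 0)"
  "x = s (Suc 0) * h + s 0 * g \<Longrightarrow> x \<in> lincomb s UNIV (Suc (Suc 0))"
  "x = s (Suc (Suc 0)) * k + (s (Suc 0) * h + s 0 * g) \<Longrightarrow> x \<in> lincomb s UNIV (Suc (Suc (Suc 0)))"
proof -
  show 1: "x = s 0 * g \<Longrightarrow> x \<in> lincomb s UNIV (Suc 0)" for x
    by auto
  show 2: "x = s (Suc 0) * h + s 0 * g \<Longrightarrow> x \<in> lincomb s UNIV (Suc (Suc 0))" for x
    using lincomb_SucI[OF UNIV_I 1[OF refl]] by (simp only:)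
  show "x = s (Suc (Suc 0)) * k + (s (Suc 0) * h + s 0 * g) \<Longrightarrow> x \<in> lincomb s UNIV (Suc (Suc (Suc 0)))"
    using lincomb_SucI[OF UNIV_I 2[OF refl]] by (simp only:)
qed

lemma subst_lincomb_zero:
  assumes "\<And>j. j < i \<Longrightarrow> subst f (s j) = 0"
  shows "x \<in> lincomb s UNIV i \<Longrightarrow> subst f x = 0"
  using assms by (induction i arbitrary: x) (auto simp: subst_simps)

text \<open>The monomial parametrisation $(x_0, x_1, w, wz, wz^2)$ of the quadric $x_2x_4 = x_3^2$.\<close>

definition quadric_cone :: "5 \<Rightarrow> (5, 'k::field_char_0) mpoly" where
  "quadric_cone v = (if v = 0 then x0 else if v = 1 then x1 else if v = 2 then x2
     else if v = 3 then x2 * x3 else x2 * (x3 * x3))"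

text \<open>Modulo $x_3^2 - x_2x_4$ the monomials with exponent at most 1 at $x_3$ suffice, and they are
  sent to distinct monomials, the exponent at $x_3$ being determined by a parity.\<close>

lemma quadric_cone_kernel:
  fixes u :: "(5, 'k::field_char_0) mpoly"
  assumes "subst quadric_cone u = 0"
  shows "u \<in> lincomb hankel_gen UNIV (Suc 0)"
proof -
  let ?K = "lincomb hankel_gen UNIV (Suc 0) :: (5, 'k) mpoly set"
  define N :: "(nat \<times> nat \<times> nat \<times> nat \<times> nat) set" where "N = {(i, j, k, l, e). e \<le> 1}"
  define b :: "nat \<times> nat \<times> nat \<times> nat \<times> nat \<Rightarrow> (5, 'k) mpoly"
    where "b = (\<lambda>(i, j, k, l, e). x0 ^ i * x1 ^ j * x2 ^ k * x4 ^ l * x3 ^ e)"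
  define E :: "nat \<times> nat \<times> nat \<times> nat \<times> nat \<Rightarrow> 5 \<Rightarrow>\<^sub>0 nat"
    where "E = (\<lambda>(i, j, k, l, e). Poly_Mapping.single 0 i + Poly_Mapping.single 1 j
      + Poly_Mapping.single 2 (k + l + e) + Poly_Mapping.single 3 (2 * l + e))"
  have step: "\<exists>c. \<exists>n'\<in>N. mvar v * b n - mconst c * b n' \<in> ?K" if "n \<in> N" for n v
  proof -
    obtain i j k l e where n: "n = (i, j, k, l, e)" "e \<le> 1"
      using \<open>n \<in> N\<close> by (auto simp: N_def)
    note same = exact_step[OF ideal_lincomb]
    consider "v = 0" | "v = 1" | "v = 2" | "v = 4" | "v = 3" "e = 0" | "v = 3" "e = 1"
      using exhaust_5[of v] n(2) by linarith
    then show ?thesis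
    proof cases
      case 1
      then show ?thesis
        using n by (intro same[of "(Suc i, j, k, l, e)"]) (auto simp: N_def b_def mult_ac)
    next
      case 2
      then show ?thesis
        using n by (intro same[of "(i, Suc j, k, l, e)"]) (auto simp: N_def b_def mult_ac)
    next
      case 3
      then show ?thesis
        using n by (intro same[of "(i, j, Suc k, l, e)"]) (auto simp: N_def b_def mult_ac)
    next
      case 4
      then show ?thesis
        using n by (intro same[of "(i, j, k, Suc l, e)"]) (auto simp: N_def b_def mult_ac)
    next
      case 5
      then show ?thesis
        using n by (intro same[of "(i, j, k, l, 1)"]) (auto simp: N_def b_def mult_ac)
    next
      case 6
      have "mvar v * b n - mconst 1 * b (i, j, Suc k, Suc l, 0)
          = hankel_gen 0 * (- (x0 ^ i * x1 ^ j * x2 ^ k * x4 ^ l))"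
        using n 6 by (simp add: b_def mconst_simps hankel_gen_simps algebra_simps)
      from lincomb_intros(1)[of _ hankel_gen, OF this] show ?thesis
        by (intro exI bexI) (auto simp: N_def)
    qed
  qed
  have "b (0, 0, 0, 0, 0) = 1"
    by (simp add: b_def)
  then have "u * 1 \<in> span_mod N b ?K"
    using span_mod_mult[OF ideal_lincomb step span_mod_basis[OF ideal_lincomb step, of "(0, 0, 0, 0, 0)" 1]]
    by (auto simp: N_def mconst_simps)
  then show ?thesis
  proof (intro subst_kernel[OF ideal_lincomb, where f = quadric_cone and E = E and w = "\<lambda>_. 1"])
    show "inj_on E N"
    proof (rule inj_onI)
      fix n m assume nm: "n \<in> N" "m \<in> N" "E n = E m"
      then obtain i j k l e i' j' k' l' e' where tuples: "n = (i, j, k, l, e)" "m = (i', j', k', l', e')"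
        "e \<le> 1" "e' \<le> 1"
        by (auto simp: N_def)
      have lookups: "Poly_Mapping.lookup (E n) v = Poly_Mapping.lookup (E m) v" for v
        using nm by simp
      have exps: "i = i'" "j = j'" "k + l + e = k' + l' + e'" "2 * l + e = 2 * l' + e'"
        using lookups[of 0] lookups[of 1] lookups[of 2] lookups[of 3] unfolding tuples
        by (simp_all add: E_def lookup_add lookup_single)
      have "e = e'"
        using exps(4) tuples(3,4) by presburger
      then show "n = m"
        using exps tuples(1,2) by simp
    qed
    show "subst quadric_cone (b n) = Poly_Mapping.single (E n) 1" if "n \<in> N" for n
    proof -
      obtain i j k l e where n: "n = (i, j, k, l, e)"
        by (cases n)
      have "subst quadric_cone (b n) = x0 ^ i * x1 ^ j * x2 ^ (k + l + e) * x3 ^ (l + l + e)"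
        by (simp add: n b_def quadric_cone_def subst_simps subst_power power_mult_distrib
            power_add power_mult mult_ac)
      also have "\<dots> = Poly_Mapping.single (E n) 1"
        by (simp add: n E_def mvar_power mult_single add.assoc mult_2)
      finally show ?thesis .
    qed
    show "subst quadric_cone x = 0" if "x \<in> ?K" for x
      using _ that
      by (rule subst_lincomb_zero)
         (simp add: hankel_gen_simps quadric_cone_def subst_simps power2_eq_square algebra_simps)
  qed (use assms in auto)
qed

text \<open>The monomial parametrisation $(wy^2, wy, w, wz, wz^2)$ of the intersection of the quadrics
  $x_2x_4 = x_3^2$ and $x_0x_2 = x_1^2$.\<close>

definition quadric_pair_cone :: "5 \<Rightarrow> (5, 'k::field_char_0) mpoly" where
  "quadric_pair_cone v = (if v = 0 then x2 * (x0 * x0) else if v = 1 then x2 * x0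
     else if v = 2 then x2 else if v = 3 then x2 * x4 else x2 * (x4 * x4))"

text \<open>Here the normal monomials have exponents at most 1 at $x_1$ and at $x_3$, again recovered from
  parities.\<close>

lemma quadric_pair_cone_kernel:
  fixes u :: "(5, 'k::field_char_0) mpoly"
  assumes "subst quadric_pair_cone u = 0"
  shows "u \<in> lincomb hankel_gen UNIV (Suc (Suc 0))"
proof -
  let ?K = "lincomb hankel_gen UNIV (Suc (Suc 0)) :: (5, 'k) mpoly set"
  define N :: "(nat \<times> nat \<times> nat \<times> nat \<times> nat) set" where "N = {(i, j, k, d, e). d \<le> 1 \<and> e \<le> 1}"
  define b :: "nat \<times> nat \<times> nat \<times> nat \<times> nat \<Rightarrow> (5, 'k) mpoly"
    where "b = (\<lambda>(i, j, k, d, e). x0 ^ i * x2 ^ j * x4 ^ k * x1 ^ d * x3 ^ e)"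
  define E :: "nat \<times> nat \<times> nat \<times> nat \<times> nat \<Rightarrow> 5 \<Rightarrow>\<^sub>0 nat"
    where "E = (\<lambda>(i, j, k, d, e). Poly_Mapping.single 0 (2 * i + d)
      + Poly_Mapping.single 2 (i + j + k + d + e) + Poly_Mapping.single 4 (2 * k + e))"
  have step: "\<exists>c. \<exists>n'\<in>N. mvar v * b n - mconst c * b n' \<in> ?K" if "n \<in> N" for n v
  proof -
    obtain i j k d e where n: "n = (i, j, k, d, e)" "d \<le> 1" "e \<le> 1"
      using \<open>n \<in> N\<close> by (auto simp: N_def)
    note same = exact_step[OF ideal_lincomb]
    consider "v = 0" | "v = 2" | "v = 4" | "v = 1" "d = 0" | "v = 1" "d = 1" | "v = 3" "e = 0" | "v = 3" "e = 1"
      using exhaust_5[of v] n(2,3) by linarith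
    then show ?thesis
    proof cases
      case 1
      then show ?thesis
        using n by (intro same[of "(Suc i, j, k, d, e)"]) (auto simp: N_def b_def mult_ac)
    next
      case 2
      then show ?thesis
        using n by (intro same[of "(i, Suc j, k, d, e)"]) (auto simp: N_def b_def mult_ac)
    next
      case 3
      then show ?thesis
        using n by (intro same[of "(i, j, Suc k, d, e)"]) (auto simp: N_def b_def mult_ac)
    next
      case 4
      then show ?thesis
        using n by (intro same[of "(i, j, k, 1, e)"]) (auto simp: N_def b_def mult_ac)
    next
      case 5
      have "mvar v * b n - mconst 1 * b (Suc i, Suc j, k, 0, e)
          = hankel_gen (Suc 0) * (- (x0 ^ i * x2 ^ j * x4 ^ k * x3 ^ e)) + hankel_gen 0 * 0"
        using n 5 by (simp add: b_def mconst_simps hankel_gen_simps algebra_simps)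
      from lincomb_intros(2)[of _ hankel_gen, OF this] show ?thesis
        by (intro exI bexI) (use n in \<open>auto simp: N_def\<close>)
    next
      case 6
      then show ?thesis
        using n by (intro same[of "(i, j, k, d, 1)"]) (auto simp: N_def b_def mult_ac)
    next
      case 7
      have "mvar v * b n - mconst 1 * b (i, Suc j, Suc k, d, 0)
          = hankel_gen (Suc 0) * 0 + hankel_gen 0 * (- (x0 ^ i * x2 ^ j * x4 ^ k * x1 ^ d))"
        using n 7 by (simp add: b_def mconst_simps hankel_gen_simps algebra_simps)
      from lincomb_intros(2)[of _ hankel_gen, OF this] show ?thesis
        by (intro exI bexI) (use n in \<open>auto simp: N_def\<close>)
    qed
  qed
  have "b (0, 0, 0, 0, 0) = 1"
    by (simp add: b_def)
  then have "u * 1 \<in> span_mod N b ?K"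
    using span_mod_mult[OF ideal_lincomb step span_mod_basis[OF ideal_lincomb step, of "(0, 0, 0, 0, 0)" 1]]
    by (auto simp: N_def mconst_simps)
  then show ?thesis
  proof (intro subst_kernel[OF ideal_lincomb, where f = quadric_pair_cone and E = E and w = "\<lambda>_. 1"])
    show "inj_on E N"
    proof (rule inj_onI)
      fix n m assume nm: "n \<in> N" "m \<in> N" "E n = E m"
      then obtain i j k d e i' j' k' d' e' where tuples: "n = (i, j, k, d, e)" "m = (i', j', k', d', e')"
        "d \<le> 1" "e \<le> 1" "d' \<le> 1" "e' \<le> 1"
        by (auto simp: N_def)
      have lookups: "Poly_Mapping.lookup (E n) v = Poly_Mapping.lookup (E m) v" for v
        using nm by simp
      have exps: "2 * i + d = 2 * i' + d'" "i + j + k + d + e = i' + j' + k' + d' + e'"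
        "2 * k + e = 2 * k' + e'"
        using lookups[of 0] lookups[of 2] lookups[of 4] unfolding tuples
        by (simp_all add: E_def lookup_add lookup_single)
      have "d = d'" "e = e'"
        using exps(1,3) tuples(3-6) by presburger+
      then show "n = m"
        using exps tuples(1,2) by simp
    qed
    show "subst quadric_pair_cone (b n) = Poly_Mapping.single (E n) 1" if "n \<in> N" for n
    proof -
      obtain i j k d e where n: "n = (i, j, k, d, e)"
        by (cases n)
      have "subst quadric_pair_cone (b n) = x0 ^ (i + i + d) * x2 ^ (i + j + k + d + e) * x4 ^ (k + k + e)"
        by (simp add: n b_def quadric_pair_cone_def subst_simps subst_power power_mult_distrib
            power_add power_mult mult_ac)
      also have "\<dots> = Poly_Mapping.single (E n) 1"
        by (simp add: n E_def mvar_power mult_single add.assoc mult_2)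
      finally show ?thesis .
    qed
    show "subst quadric_pair_cone x = 0" if "x \<in> ?K" for x
      using _ that
      by (rule subst_lincomb_zero)
         (auto simp: less_Suc_eq hankel_gen_simps quadric_pair_cone_def subst_simps power2_eq_square algebra_simps)
  qed (use assms in auto)
qed


section \<open>The residual curve\<close>

text \<open>The cone over the residual curve, with $x_0$ as the scaling and $x_1$ as the parameter on the
  right-hand side.\<close>

definition residual_cone :: "5 \<Rightarrow> (5, 'k::field_char_0) mpoly" where
  "residual_cone v = (if v = 0 then x0 else if v = 1 then x0 * x1 else if v = 2 then x0 * x1 ^ 2
     else if v = 3 then - 3 * (x0 * x1 ^ 3) else 9 * (x0 * x1 ^ 4))"

lemma residual_cone_hankel_gen: "j < 3 \<Longrightarrow> subst residual_cone (hankel_gen j) = 0"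
  by (auto simp: numeral_3_eq_3 less_Suc_eq hankel_gen_simps residual_cone_def subst_simps subst_numeral
      power_numeral_reduce algebra_simps)

definition minor_m :: "(5, 'k::field_char_0) mpoly" where
  "minor_m = x1 * x3 - x0 * x4"

text \<open>These four polynomials generate the ideal of the rational normal curve modulo
  $(a_0, a_1, a_2)$, even as a module over $k[x_0, x_4]$: the multiplication by $x_1$, $x_2$ and $x_3$
  is given by \<open>residual_syzygies\<close>.\<close>

definition residual_basis :: "nat \<Rightarrow> (5, 'k::field_char_0) mpoly" where
  "residual_basis k = [minor_m, minor_p, x2 * minor_m, minor_q] ! k"

lemma third: "3 * mconst (1 / 3 :: 'k::field_char_0) = (1 :: (5, 'k) mpoly)"
  unfolding mconst_numeral[symmetric] mconst_simps(4)[symmetric] by (simp add: mconst_simps)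

abbreviation "t3 \<equiv> mconst (1 / 3 :: 'k::field_char_0) :: (5, 'k) mpoly"

text \<open>The multiplication table of \<open>residual_basis\<close> modulo $(a_0, a_1, a_2)$, obtained by rewriting
  $x_3^2 = x_2x_4$, $x_1^2 = x_0x_2$ and $x_2^2 = (x_0x_4 + 2x_1x_3)/3$, where \<open>t\<close> stands for
  one third.\<close>

lemma residual_syzygies:
  fixes y0 y1 y2 y3 y4 a0 a1 a2 m p q t :: "'a::comm_ring_1"
  assumes a: "a0 = y2 * y4 - y3 * y3" "a1 = y0 * y2 - y1 * y1"
      "a2 = y0 * y4 + 2 * y1 * y3 - 3 * y2 * y2"
    and minors: "m = y1 * y3 - y0 * y4" "p = y2 * y3 - y1 * y4" "q = y1 * y2 - y0 * y3"
    and t: "3 * t = 1"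
  shows "y1 * m - y0 * p = a2 * 0 + (a1 * - y3 + a0 * 0)"
    and "y3 * m - y4 * q = a2 * 0 + (a1 * 0 + a0 * - y1)"
    and "y1 * p - y2 * m = a2 * 0 + (a1 * y4 + a0 * 0)"
    and "y2 * p + t * y4 * q = a2 * (- t * y3) + (a1 * 0 + a0 * (- 2 * t * y1))"
    and "y3 * p + t * y4 * m = a2 * (- t * y4) + (a1 * 0 + a0 * - y2)"
    and "y1 * (y2 * m) + t * y0 * y4 * q
      = a2 * (- t * y0 * y3) + (a1 * (- y2 * y3) + a0 * (- 2 * t * y0 * y1))"
    and "y2 * (y2 * m) - t * t * y0 * y4 * m
      = a2 * (- 2 * t * t * y0 * y4 - t * m) + (a1 * (- 2 * t * y3 * y3) + a0 * (- 2 * t * y0 * y2))"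
    and "y3 * (y2 * m) + t * y0 * y4 * p
      = a2 * (- t * y1 * y4) + (a1 * (- 2 * t * y3 * y4) + a0 * (- y1 * y2))"
    and "y1 * q + t * y0 * m = a2 * (- t * y0) + (a1 * - y2 + a0 * 0)"
    and "y2 * q + t * y0 * p = a2 * (- t * y1) + (a1 * (- 2 * t * y3) + a0 * 0)"
    and "y3 * q - y2 * m = a2 * 0 + (a1 * 0 + a0 * y0)"
proof -
  \<comment> \<open>An identity that needs \<open>3 * t = 1\<close> has a multiple of \<open>1 - 3 * t\<close> as the difference of its sides.\<close>
  have third: "l = r" if "l - r = (1 - 3 * t) * d" for l r d :: 'a
    using that t by simp
  show "y1 * m - y0 * p = a2 * 0 + (a1 * - y3 + a0 * 0)"
    by (simp add: a minors algebra_simps)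
  show "y3 * m - y4 * q = a2 * 0 + (a1 * 0 + a0 * - y1)"
    by (simp add: a minors algebra_simps)
  show "y1 * p - y2 * m = a2 * 0 + (a1 * y4 + a0 * 0)"
    by (simp add: a minors algebra_simps)
  show "y2 * p + t * y4 * q = a2 * (- t * y3) + (a1 * 0 + a0 * (- 2 * t * y1))"
    by (rule third[of _ _ "y2 * y2 * y3 - y1 * y2 * y4"])
      (simp add: a minors algebra_simps)
  show "y3 * p + t * y4 * m = a2 * (- t * y4) + (a1 * 0 + a0 * - y2)"
    by (rule third[of _ _ "y2 * y2 * y4 - y1 * y3 * y4"])
      (simp add: a minors algebra_simps)
  show "y1 * (y2 * m) + t * y0 * y4 * q
      = a2 * (- t * y0 * y3) + (a1 * (- y2 * y3) + a0 * (- 2 * t * y0 * y1))"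
    by (rule third[of _ _ "y0 * y2 * y2 * y3 - y0 * y1 * y2 * y4"])
      (simp add: a minors algebra_simps)
  show "y2 * (y2 * m) - t * t * y0 * y4 * m
      = a2 * (- 2 * t * t * y0 * y4 - t * m) + (a1 * (- 2 * t * y3 * y3) + a0 * (- 2 * t * y0 * y2))"
    by (rule third[of _ _ "y1 * y2 * y2 * y3 - y0 * y2 * y2 * y4
        + t * (2 * y0 * y2 * y2 * y4 - y0 * y1 * y3 * y4 - y0 * y0 * y4 * y4)"])
      (simp add: a minors algebra_simps)
  show "y3 * (y2 * m) + t * y0 * y4 * p
      = a2 * (- t * y1 * y4) + (a1 * (- 2 * t * y3 * y4) + a0 * (- y1 * y2))"
    by (rule third[of _ _ "y1 * y2 * y2 * y4 - y0 * y2 * y3 * y4"])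
      (simp add: a minors algebra_simps)
  show "y1 * q + t * y0 * m = a2 * (- t * y0) + (a1 * - y2 + a0 * 0)"
    by (rule third[of _ _ "y0 * y2 * y2 - y0 * y1 * y3"])
      (simp add: a minors algebra_simps)
  show "y2 * q + t * y0 * p = a2 * (- t * y1) + (a1 * (- 2 * t * y3) + a0 * 0)"
    by (rule third[of _ _ "y1 * y2 * y2 - y0 * y2 * y3"])
      (simp add: a minors algebra_simps)
  show "y3 * q - y2 * m = a2 * 0 + (a1 * 0 + a0 * y0)"
    by (simp add: a minors algebra_simps)
qed

lemmas residual_relations = residual_syzygies[OF hankel_gen_simps(1-3)
    minor_m_def minor_p_def minor_q_def third,
    THEN lincomb_intros(3)[where s = "hankel_gen :: nat \<Rightarrow> (5, 'k::field_char_0) mpoly"]]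

text \<open>An element of \<open>J\<close> is, modulo $(a_0, a_1, a_2)$, a linear combination of the products
  $x_0^i x_4^j e_k$ with $e_k$ from \<open>residual_basis\<close>.  On the residual cone these become multiples
  of distinct monomials, as $x_4$ contributes an exponent 4 of the parameter and the four basis
  elements have the exponents 4, 5, 6 and 3.\<close>

lemma residual_cone_kernel:
  fixes u :: "(5, 'k::field_char_0) mpoly"
  assumes "u \<in> lincomb hankel_gen UNIV 5" "subst residual_cone u = 0"
  shows "u \<in> lincomb hankel_gen UNIV (Suc (Suc (Suc 0)))"
proof -
  let ?K = "lincomb hankel_gen UNIV (Suc (Suc (Suc 0))) :: (5, 'k) mpoly set"
  define N :: "(nat \<times> nat \<times> nat) set" where "N = {(i, j, k). k < 4}"
  define b :: "nat \<times> nat \<times> nat \<Rightarrow> (5, 'k) mpoly"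
    where "b = (\<lambda>(i, j, k). x0 ^ i * x4 ^ j * residual_basis k)"
  define E :: "nat \<times> nat \<times> nat \<Rightarrow> 5 \<Rightarrow>\<^sub>0 nat"
    where "E = (\<lambda>(i, j, k). Poly_Mapping.single 0 (i + j + (if k = 2 then 3 else 2))
      + Poly_Mapping.single 1 (4 * j + (if k = 3 then 3 else 4 + k)))"
  define w :: "nat \<times> nat \<times> nat \<Rightarrow> 'k"
    where "w = (\<lambda>(i, j, k). 9 ^ j * (if k = 3 then 4 else - 12))"
  have step: "\<exists>c. \<exists>n'\<in>N. mvar v * b n - mconst c * b n' \<in> ?K" if "n \<in> N" for n v
  proof -
    obtain i j k where n: "n = (i, j, k)" "k < 4"
      using \<open>n \<in> N\<close> by (auto simp: N_def)
    have reduce: ?thesis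
      if "mvar v * residual_basis k - mconst c * (x0 ^ i' * x4 ^ j' * residual_basis k') \<in> ?K" "k' < 4"
      for c i' j' k'
    proof -
      have "(x0 ^ i * x4 ^ j) * (mvar v * residual_basis k - mconst c * (x0 ^ i' * x4 ^ j' * residual_basis k')) \<in> ?K"
        by (rule lincomb_UNIV_closed(2)[OF that(1)])
      then have "mvar v * b n - mconst c * b (i + i', j + j', k') \<in> ?K"
        by (simp add: n b_def algebra_simps power_add)
      then show ?thesis
        using \<open>k' < 4\<close> by (intro exI bexI) (auto simp: N_def)
    qed
    have ninth: "mconst (1 / 9) = t3 * (t3 :: (5, 'k) mpoly)"
      by (simp flip: mconst_simps(4))
    note rel = residual_relations[where 'k = 'k]
    consider "v = 0" | "v = 4" | "v = 1" "k = 0" | "v = 1" "k = 1" | "v = 1" "k = 2" | "v = 1" "k = 3"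
      | "v = 2" "k = 0" | "v = 2" "k = 1" | "v = 2" "k = 2" | "v = 2" "k = 3"
      | "v = 3" "k = 0" | "v = 3" "k = 1" | "v = 3" "k = 2" | "v = 3" "k = 3"
    proof -
      have "k = 0 \<or> k = 1 \<or> k = 2 \<or> k = 3"
        using n(2) by arith
      then show thesis
        using exhaust_5[of v] that by (elim disjE) simp_all
    qed
    then show ?thesis
    proof cases
      case 1
      show ?thesis
        using 1 n by (intro reduce[of 1 1 0 k])
          (auto simp: mconst_simps zero_in_lincomb simp del: lincomb.simps)
    next
      case 2
      show ?thesis
        using 2 n by (intro reduce[of 1 0 1 k])
          (auto simp: mconst_simps zero_in_lincomb simp del: lincomb.simps)
    next
      case 3
      show ?thesis
        using 3 rel(1) by (intro reduce[of 1 1 0 1])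
          (auto simp: residual_basis_def mconst_simps simp del: lincomb.simps)
    next
      case 4
      show ?thesis
        using 4 rel(3) by (intro reduce[of 1 0 0 2])
          (auto simp: residual_basis_def mconst_simps simp del: lincomb.simps)
    next
      case 5
      show ?thesis
        using 5 rel(6) by (intro reduce[of "- 1 / 3" 1 1 3])
          (auto simp: residual_basis_def mconst_simps mult.assoc simp del: lincomb.simps)
    next
      case 6
      show ?thesis
        using 6 rel(9) by (intro reduce[of "- 1 / 3" 1 0 0])
          (auto simp: residual_basis_def mconst_simps mult.assoc simp del: lincomb.simps)
    next
      case 7
      show ?thesis
        using 7 by (intro reduce[of 1 0 0 2])
          (auto simp: residual_basis_def mconst_simps zero_in_lincomb simp del: lincomb.simps)
    next
      case 8
      show ?thesis
        using 8 rel(4) by (intro reduce[of "- 1 / 3" 0 1 3])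
          (auto simp: residual_basis_def mconst_simps mult.assoc simp del: lincomb.simps)
    next
      case 9
      show ?thesis
        using 9 rel(7) by (intro reduce[of "1 / 9" 1 1 0])
          (auto simp: residual_basis_def ninth mult.assoc simp del: lincomb.simps)
    next
      case 10
      show ?thesis
        using 10 rel(10) by (intro reduce[of "- 1 / 3" 1 0 1])
          (auto simp: residual_basis_def mconst_simps mult.assoc simp del: lincomb.simps)
    next
      case 11
      show ?thesis
        using 11 rel(2) by (intro reduce[of 1 0 1 3])
          (auto simp: residual_basis_def mconst_simps simp del: lincomb.simps)
    next
      case 12
      show ?thesis
        using 12 rel(5) by (intro reduce[of "- 1 / 3" 0 1 0])
          (auto simp: residual_basis_def mconst_simps mult.assoc simp del: lincomb.simps)
    next
      case 13
      show ?thesis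
        using 13 rel(8) by (intro reduce[of "- 1 / 3" 1 1 1])
          (auto simp: residual_basis_def mconst_simps mult.assoc simp del: lincomb.simps)
    next
      case 14
      show ?thesis
        using 14 rel(11) by (intro reduce[of 1 0 0 2])
          (auto simp: residual_basis_def mconst_simps simp del: lincomb.simps)
    qed
  qed
  note span = span_mod_add[OF ideal_lincomb step] span_mod_mult[OF ideal_lincomb step]
    span_mod_ideal[OF ideal_lincomb step] span_mod_basis[OF ideal_lincomb step]
  have pq: "minor_p \<in> span_mod N b ?K" "minor_q \<in> span_mod N b ?K"
    using span(4)[of "(0, 0, 1)" 1] span(4)[of "(0, 0, 3)" 1]
    by (simp_all add: N_def b_def residual_basis_def mconst_simps del: lincomb.simps)
  have "u \<in> lincomb hankel_gen UNIV (Suc (Suc (Suc (Suc (Suc 0)))))"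
    using assms(1) by (simp add: eval_nat_numeral del: lincomb.simps)
  then obtain r h where r: "u = hankel_gen (Suc (Suc (Suc (Suc 0)))) * r + h"
      and h: "h \<in> lincomb hankel_gen UNIV (Suc (Suc (Suc (Suc 0))))"
    by (rule lincomb_SucE)
  from h obtain s z where "h = hankel_gen (Suc (Suc (Suc 0))) * s + z" and z: "z \<in> ?K"
    by (rule lincomb_SucE)
  with r have u: "u = hankel_gen (Suc (Suc (Suc (Suc 0)))) * r + (hankel_gen (Suc (Suc (Suc 0))) * s + z)"
    by simp
  have "r * minor_q + (s * (minor_p + 3 * minor_q) + z) \<in> span_mod N b ?K"
    by (intro span(1) span(2) span(3) pq z)
  then have span_u: "u \<in> span_mod N b ?K"
    by (simp only: u hankel_gen_simps mult.commute)
  show ?thesis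
  proof (rule subst_kernel[OF ideal_lincomb _ _ _ _ span_u assms(2), where E = E and w = w])
    show "inj_on E N"
    proof (rule inj_onI)
      fix n m assume nm: "n \<in> N" "m \<in> N" "E n = E m"
      then obtain i j k i' j' k' where tuples: "n = (i, j, k)" "m = (i', j', k')" "k < 4" "k' < 4"
        by (auto simp: N_def)
      have lookups: "Poly_Mapping.lookup (E n) v = Poly_Mapping.lookup (E m) v" for v
        using nm by simp
      have exps: "i + j + (if k = 2 then 3 else 2) = i' + j' + (if k' = 2 then 3 else 2)"
        "4 * j + (if k = 3 then 3 else 4 + k) = 4 * j' + (if k' = 3 then 3 else 4 + k')"
        using lookups[of 0] lookups[of 1] unfolding tuples
        by (simp_all only: E_def lookup_add lookup_single prod.case) simp_all
      have "k = k'"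
        using exps(2) tuples(3,4) by (simp split: if_splits; presburger)
      then show "n = m"
        using exps tuples(1,2) by (simp split: if_splits)
    qed
    show "subst residual_cone (b n) = Poly_Mapping.single (E n) (w n)" if "n \<in> N" for n
    proof -
      obtain i j k where n: "n = (i, j, k)" "k < 4"
        using \<open>n \<in> N\<close> by (auto simp: N_def)
      have "k = 0 \<or> k = 1 \<or> k = 2 \<or> k = 3"
        using n(2) by arith
      then have "subst residual_cone (residual_basis k) = mconst (if k = 3 then 4 else - 12 :: 'k)
          * x0 ^ (if k = 2 then 3 else 2) * x1 ^ (if k = 3 then 3 else 4 + k)"
        by (auto simp: residual_basis_def minor_m_def minor_p_def minor_q_def residual_cone_def
            subst_simps mconst_numeral mconst_simps eval_nat_numeral algebra_simps)
      then have "subst residual_cone (b n) = x0 ^ i * (9 * (x0 * x1 ^ 4)) ^ j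
          * (mconst (if k = 3 then 4 else - 12 :: 'k)
            * x0 ^ (if k = 2 then 3 else 2) * x1 ^ (if k = 3 then 3 else 4 + k))"
        by (simp add: n b_def subst_simps(4) subst_power) (simp add: subst_simps residual_cone_def)
      also have "\<dots> = mconst (w n) * (x0 ^ (i + j + (if k = 2 then 3 else 2))
          * x1 ^ (4 * j + (if k = 3 then 3 else 4 + k)))"
        by (simp only: n w_def prod.case mconst_simps mconst_power mconst_numeral power_mult_distrib
            power_add mult_ac flip: power_mult)
      also have "\<dots> = Poly_Mapping.single (E n) (w n)"
        by (simp only: n E_def mvar_power mult_single mconst_def prod.case) simp
      finally show ?thesis .
    qed
    show "w n \<noteq> 0" for n
      by (simp add: w_def split: prod.split)
    show "subst residual_cone x = 0" if "x \<in> ?K" for x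
      using _ that by (rule subst_lincomb_zero) (simp add: residual_cone_hankel_gen)
  qed
qed

text \<open>For $e = \pm 1$, the line in the residual cone on which the parameter is \<open>e\<close>.  On these two lines
  the generator \<open>minor_p + 3 * minor_q\<close> vanishes while \<open>minor_q\<close> does not.\<close>

definition residual_line :: "'k \<Rightarrow> 5 \<Rightarrow> (5, 'k::field_char_0) mpoly" where
  "residual_line e v = (if v = 0 then x0 else if v = 1 then mconst e * x0 else if v = 2 then x0
     else if v = 3 then - 3 * (mconst e * x0) else 9 * x0)"

lemma residual_line_hankel_gen:
  assumes e: "e * e = 1" and "j < 4"
  shows "subst (residual_line e) (hankel_gen j) = 0"
proof -
  have ee: "mconst e * (mconst e * p) = (p :: (5, 'a) mpoly)" for p
    using e by (simp add: mconst_simps flip: mult.assoc mconst_simps(4))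
  have "j = 0 \<or> j = 1 \<or> j = 2 \<or> j = 3"
    using \<open>j < 4\<close> by arith
  then show ?thesis
    by (auto simp: hankel_gen_def minor_p_def minor_q_def residual_line_def subst_simps subst_numeral
        ee algebra_simps)
qed

lemma residual_line_minor_q: "subst (residual_line e) minor_q = 4 * (mconst e * (x0 * x0))"
  by (simp add: minor_q_def residual_line_def subst_simps algebra_simps)


text \<open>Write \<open>u\<close> as a multiple $q\alpha$ of \<open>minor_q\<close> plus an element of $(a_0,\ldots,a_3)$.  The
  hypothesis makes $\alpha$ vanish on both lines, and the colon ideal \<open>W\<close> of \<open>minor_q\<close> contains
  enough polynomials that vanish on the lines to contain $\alpha$ too.\<close>

lemma minor_q_colon:
  fixes u :: "(5, 'k::field_char_0) mpoly"
  assumes u: "u \<in> lincomb hankel_gen UNIV 5"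
    and colon: "hankel_gen 4 * u \<in> lincomb hankel_gen UNIV 4"
  shows "u \<in> lincomb hankel_gen UNIV 4"
proof -
  let ?K = "lincomb hankel_gen UNIV 4 :: (5, 'k) mpoly set"
  note K = lincomb_UNIV_closed[of _ hankel_gen 4]
  define W where "W = {w :: (5, 'k) mpoly. minor_q * w \<in> ?K}"
  have ideal_W: "ideal W ring_of_type_algebra"
  proof (rule ideal_typeI)
    show "0 \<in> W"
      by (simp add: W_def zero_in_lincomb)
    show "v + w \<in> W" if "v \<in> W" "w \<in> W" for v w
      using K(1)[of "minor_q * v" "minor_q * w"] that by (simp add: W_def distrib_left)
    show "r * w \<in> W" if "w \<in> W" for r w
      using K(2)[of "minor_q * w" r] that by (simp add: W_def mult.left_commute)
  qed
  note W = ideal_type_closed[OF ideal_W]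
  have K3: "x \<in> ?K" if "x \<in> lincomb hankel_gen UNIV (Suc (Suc (Suc 0)))" for x
    using that by (rule subsetD[OF lincomb_le, rotated 2]) simp_all
  have gen: "(minor_p + 3 * minor_q) * g \<in> ?K" for g
    using generator_in_lincomb[of UNIV g 3 4 hankel_gen] by (simp add: hankel_gen_def)
  have gen1: "(x0 * x2 - x1 * x1) * g \<in> ?K" for g
    using generator_in_lincomb[of UNIV g 1 4 hankel_gen] by (simp add: hankel_gen_def)
  note rel = residual_relations[where 'k = 'k, THEN K3]
  have "minor_q * (x2 - x0) - ((x2 * minor_q + t3 * x0 * minor_p) - (minor_p + 3 * minor_q) * (t3 * x0))
      = (3 * t3 - 1) * (x0 * minor_q)"
    by (simp add: algebra_simps)
  then have "minor_q * (x2 - x0) = (x2 * minor_q + t3 * x0 * minor_p) - (minor_p + 3 * minor_q) * (t3 * x0)"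
    by (simp add: third)
  also have "\<dots> \<in> ?K"
    by (intro K(3) rel gen)
  finally have W2: "x2 - x0 \<in> W"
    by (simp add: W_def)
  have "minor_q * (x3 + 3 * x1) = (x3 * minor_q - x2 * minor_m) - (x1 * minor_p - x2 * minor_m)
      + (minor_p + 3 * minor_q) * x1"
    by (simp add: algebra_simps)
  also have "\<dots> \<in> ?K"
    by (intro K(1,3) rel gen)
  finally have W3: "x3 + 3 * x1 \<in> W"
    by (simp add: W_def)
  have "minor_q * (x4 - 9 * x0) - (3 * (x2 * minor_p + t3 * x4 * minor_q)
      + 9 * (x2 * minor_q + t3 * x0 * minor_p) - (minor_p + 3 * minor_q) * (3 * x0 + 3 * x2))
      = (1 - 3 * t3) * (x4 * minor_q + 3 * (x0 * minor_p))"
    by (simp add: algebra_simps)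
  then have "minor_q * (x4 - 9 * x0) = 3 * (x2 * minor_p + t3 * x4 * minor_q)
      + 9 * (x2 * minor_q + t3 * x0 * minor_p) - (minor_p + 3 * minor_q) * (3 * x0 + 3 * x2)"
    by (simp add: third)
  also have "\<dots> \<in> ?K"
    by (intro K(1-3) rel gen)
  finally have W4: "x4 - 9 * x0 \<in> W"
    by (simp add: W_def)
  have "x0 * x2 - x1 * x1 \<in> W"
    using gen1[of minor_q] by (simp add: W_def mult.commute)
  then have "x0 * (x2 - x0) + - (x0 * x2 - x1 * x1) \<in> W"
    using W2 by (intro W)
  then have W1: "x1 * x1 - x0 * x0 \<in> W"
    by (simp add: algebra_simps)
  (* W vanishes on the lines: there minor_q * w is zero for w in W, and minor_q is not. *)
  have vanish_K: "subst (residual_line e) x = 0" if "e * e = 1" "x \<in> ?K" for e x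
    using _ that(2) by (rule subst_lincomb_zero) (simp add: residual_line_hankel_gen that(1))
  have cancel: "subst (residual_line e) x = 0"
    if "e * e = 1" "subst (residual_line e) (minor_q * x) = 0" for e :: 'k and x
  proof -
    have "e \<noteq> 0"
      using that(1) by auto
    then have "subst (residual_line e) minor_q \<noteq> (0 :: (5, 'k) mpoly)"
      by (simp add: residual_line_minor_q mvar_nonzero mconst_nonzero)
    then show ?thesis
      using that(2) by (simp add: subst_simps)
  qed
  have vanish_W: "subst (residual_line e) x = 0" if "e * e = 1" "x \<in> W" for e x
    using cancel[OF that(1)] vanish_K[OF that(1)] that(2) by (simp add: W_def)
  (* On one line x1 = e * x0, and the other coordinates are multiples of x0 modulo W and x1 - e * x0. *)
  have divide: "\<exists>\<beta>. x - (x1 - mconst e * x0) * \<beta> \<in> W"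
    if "subst (residual_line e) x = 0" for e :: 'k and x
  proof -
    define M where "M = {x. \<exists>\<beta>. x - (x1 - mconst e * x0) * \<beta> \<in> W}"
    have M: "x \<in> M" if "x = (x1 - mconst e * x0) * \<beta> + w" "w \<in> W" for x \<beta> w
      unfolding M_def by (intro CollectI exI[of _ \<beta>]) (simp add: that)
    have "ideal M ring_of_type_algebra"
    proof (rule ideal_typeI)
      show "0 \<in> M"
        by (rule M[of _ 0 0]) (simp_all add: W)
      fix v w assume "v \<in> M"
      then obtain \<beta> where v: "v - (x1 - mconst e * x0) * \<beta> \<in> W"
        by (auto simp: M_def)
      show "r * v \<in> M" for r
        by (rule M[OF _ W(3)[OF v, of r], of _ "r * \<beta>"]) (simp add: algebra_simps)
      assume "w \<in> M"
      then obtain \<gamma> where w: "w - (x1 - mconst e * x0) * \<gamma> \<in> W"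
        by (auto simp: M_def)
      show "v + w \<in> M"
        by (rule M[OF _ W(2)[OF v w], of _ "\<beta> + \<gamma>"]) (simp add: algebra_simps)
    qed
    moreover have "mvar v - residual_line e v \<in> M" for v
    proof -
      have "x0 - x0 \<in> M"
        by (rule M[of _ 0 0]) (simp_all add: W)
      moreover have "x1 - mconst e * x0 \<in> M"
        by (rule M[of _ 1 0]) (simp_all add: W)
      moreover have "x2 - x0 \<in> M"
        by (rule M[OF _ W2, of _ 0]) simp
      moreover have "x3 + 3 * (mconst e * x0) \<in> M"
        by (rule M[OF _ W3, of _ "- 3"]) (simp add: algebra_simps)
      moreover have "x4 - 9 * x0 \<in> M"
        by (rule M[OF _ W4, of _ 0]) simp
      ultimately show ?thesis
        using exhaust_5[of v] by (auto simp: residual_line_def)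
    qed
    ultimately have "x - subst (residual_line e) x \<in> M"
      by (rule subst_congruent)
    then show ?thesis
      using that by (simp add: M_def)
  qed
  (* Division by x1 - x0 on the first line, then of the quotient by x1 + x0 on the second one. *)
  have "u \<in> lincomb hankel_gen UNIV (Suc 4)"
    using u by (simp add: eval_nat_numeral del: lincomb.simps)
  then obtain \<alpha> z where uz: "u = hankel_gen 4 * \<alpha> + z" "z \<in> ?K"
    by (elim lincomb_SucE)
  have u_q: "u = minor_q * \<alpha> + z"
    using uz by (simp add: hankel_gen_def)
  have "minor_q * (minor_q * \<alpha>) = hankel_gen 4 * u - minor_q * z"
    by (simp add: u_q hankel_gen_def algebra_simps)
  also have "\<dots> \<in> ?K"
    by (intro K(2,3) colon uz(2))
  finally have "subst (residual_line e) \<alpha> = 0" if "e * e = 1" for e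
    using vanish_K cancel that by blast
  then have \<alpha>: "subst (residual_line 1) \<alpha> = 0" "subst (residual_line (- 1)) \<alpha> = 0"
    by simp_all
  obtain \<beta> where \<beta>: "\<alpha> - (x1 - x0) * \<beta> \<in> W"
    using divide[OF \<alpha>(1)] by (auto simp: mconst_simps)
  have "subst (residual_line (- 1)) (\<alpha> - (x1 - x0) * \<beta>) = 0"
    by (rule vanish_W[OF _ \<beta>]) simp
  then have "2 * (x0 * subst (residual_line (- 1)) \<beta>) = 0"
    using \<alpha>(2) by (simp add: subst_simps residual_line_def mconst_simps algebra_simps)
  then have "subst (residual_line (- 1)) \<beta> = 0"
    by (simp add: mvar_nonzero)
  from divide[OF this] obtain \<gamma> where \<gamma>: "\<beta> - (x1 + x0) * \<gamma> \<in> W"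
    by (auto simp: mconst_simps)
  have "(\<alpha> - (x1 - x0) * \<beta>) + (x1 - x0) * (\<beta> - (x1 + x0) * \<gamma>) + \<gamma> * (x1 * x1 - x0 * x0) \<in> W"
    by (intro W(2,3) \<beta> \<gamma> W1)
  then have "\<alpha> \<in> W"
    by (simp add: algebra_simps)
  then show ?thesis
    unfolding u_q by (intro K(1) uz(2)) (simp add: W_def)
qed

text \<open>A generator that survives a substitution killing the earlier ones can be cancelled, since the
  target is a domain.\<close>

lemma subst_colon_zero:
  fixes s :: "nat \<Rightarrow> ('x, 'k::idom) mpoly"
    and f :: "'x \<Rightarrow> ('y::linorder, 'k) mpoly"
  assumes "\<And>j. j < i \<Longrightarrow> subst f (s j) = 0" "subst f (s i) \<noteq> 0" "s i * u \<in> lincomb s UNIV i"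
  shows "subst f u = 0"
  using subst_lincomb_zero[of i f s "s i * u"] assms by (simp add: subst_simps)

lemma nonzero_by_subst: "subst f p \<noteq> 0 \<Longrightarrow> p \<noteq> 0"
  by (auto simp: subst_simps)

lemma hankel_gen_relative_regular:
  fixes u :: "(5, 'k::field_char_0) mpoly"
  assumes "i < 5" and u: "u \<in> lincomb hankel_gen UNIV 5"
    and colon: "hankel_gen i * u \<in> lincomb hankel_gen UNIV i"
  shows "u \<in> lincomb hankel_gen UNIV i"
proof -
  consider "i = 0" | "i = 1" | "i = 2" | "i = 3" | "i = 4"
    using assms(1) by linarith
  then show ?thesis
  proof cases
    case 1
    have "hankel_gen 0 \<noteq> (0 :: (5, 'k) mpoly)"
      by (rule nonzero_by_subst[where f = "\<lambda>v. if v = (3 :: 5) then 0 else (1 :: (5, 'k) mpoly)"])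
         (simp add: hankel_gen_simps subst_simps)
    then show ?thesis
      using 1 colon by simp
  next
    case 2
    have "subst quadric_cone (hankel_gen 1) \<noteq> (0 :: (5, 'k) mpoly)"
      by (rule nonzero_by_subst[where f = "\<lambda>v. if v = (1 :: 5) then 0 else (1 :: (5, 'k) mpoly)"])
         (simp add: hankel_gen_def quadric_cone_def subst_simps)
    then have "subst quadric_cone u = 0"
      using colon 2
      by (intro subst_colon_zero[of i _ hankel_gen u])
         (auto simp: hankel_gen_def quadric_cone_def subst_simps algebra_simps)
    then show ?thesis
      using quadric_cone_kernel 2 by (simp only: One_nat_def)
  next
    case 3
    have "subst quadric_pair_cone (hankel_gen 2) \<noteq> (0 :: (5, 'k) mpoly)"
      by (rule nonzero_by_subst[where f = "\<lambda>v. if v = (0 :: 5) then 0 else (1 :: (5, 'k) mpoly)"])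
         (simp add: hankel_gen_def quadric_pair_cone_def subst_simps subst_numeral)
    then have "subst quadric_pair_cone u = 0"
      using colon 3
      by (intro subst_colon_zero[of i _ hankel_gen u])
         (auto simp: less_2_cases_iff hankel_gen_def quadric_pair_cone_def subst_simps algebra_simps)
    then show ?thesis
      using quadric_pair_cone_kernel 3 by (simp only: numeral_2_eq_2)
  next
    case 4
    have "subst residual_cone (hankel_gen 3) \<noteq> (0 :: (5, 'k) mpoly)"
      by (rule nonzero_by_subst[where f = "\<lambda>v. if v = (0 :: 5) then 1 else (2 :: (5, 'k) mpoly)"])
         (simp add: hankel_gen_def minor_p_def minor_q_def residual_cone_def subst_simps subst_numeral subst_power)
    then have "subst residual_cone u = 0"
      using colon 4
      by (intro subst_colon_zero[of i _ hankel_gen u]) (auto simp: residual_cone_hankel_gen)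
    then show ?thesis
      using residual_cone_kernel[OF u] 4 by (simp only: numeral_3_eq_3)
  next
    case 5
    then show ?thesis
      using minor_q_colon[OF u] colon by simp
  qed
qed

theorem theorem3p22:
  fixes J :: "(5, 'k::field_char_0) mpoly set"
  assumes "J = gradient_ideal (det hankel3)"
  shows "linear_type J"
  unfolding assms gradient_ideal_hankel
  by (rule relative_regular_sequence_linear_type[OF hankel_gen_relative_regular])

end
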